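(* Let $k$ be a field of characteristic $2$, let $s,t$ be algebraically independent over $k$, and let $\mathfrak G(x)=x^2+sx+t$. Then for every $n\ge1$, $\operatorname{Gal}(\mathfrak G^n(x)/k(s,t))\cong R_n\rtimes R_n^*$, where $R_n=\mathbb F_2[Y]/(Y^n)$ and $R_n\rtimes R_n^*$ is the group of invertible affine linear transformations $v\mapsto uv+w$ ($u\in R_n^*$, $w\in R_n$) of $R_n$.
   Context: $\mathfrak G^n$ is the $n$-fold composition; $\operatorname{Gal}(\mathfrak G^n(x)/k(s,t))$ is the Galois group of its splitting field over $k(s,t)$. *)

theory Defs
  imports "HOL-Computational_Algebra.Computational_Algebra" "HOL-Library.Z2"
          "HOL-Library.FuncSet" "HOL-Algebra.Group"
begin

text \<open>k(s,t) with s,t algebraically independent over k is (up to k-isomorphism)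
  the field of rational functions in two indeterminates; we model it as the
  fraction field of k[s][t] = ('k poly) poly.\<close>

type_synonym 'k rat2 = "'k poly poly fract"

definition var_s :: "'k::field rat2" where
  "var_s = Fract [:[:0, 1:]:] 1"

definition var_t :: "'k::field rat2" where
  "var_t = Fract [:0, 1:] 1"

definition Gpoly :: "'k::field rat2 poly" where
  "Gpoly = [:var_t, var_s, 1:]"

definition Giter :: "nat \<Rightarrow> 'k::field rat2 poly" where
  "Giter n = ((\<lambda>p. pcompose Gpoly p) ^^ n) [:0, 1:]"

definition is_field_hom :: "('a::field \<Rightarrow> 'b::field) \<Rightarrow> bool" where
  "is_field_hom f \<longleftrightarrow> (\<forall>x y. f (x + y) = f x + f y) \<and> (\<forall>x y. f (x * y) = f x * f y) \<and> f 1 = 1"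

definition is_subfield :: "'b::field set \<Rightarrow> bool" where
  "is_subfield S \<longleftrightarrow> 0 \<in> S \<and> 1 \<in> S \<and> (\<forall>x\<in>S. \<forall>y\<in>S. x + y \<in> S \<and> x * y \<in> S)
     \<and> (\<forall>x\<in>S. - x \<in> S \<and> inverse x \<in> S)"

definition is_splitting_field :: "('a::field \<Rightarrow> 'b::field) \<Rightarrow> 'a poly \<Rightarrow> bool" where
  "is_splitting_field \<phi> p \<longleftrightarrow> is_field_hom \<phi>
     \<and> (\<exists>c rs. map_poly \<phi> p = smult c (prod_list (map (\<lambda>a. [:- a, 1:]) rs)))
     \<and> (\<forall>S. is_subfield S \<and> range \<phi> \<subseteq> S \<and> {a. poly (map_poly \<phi> p) a = 0} \<subseteq> S
            \<longrightarrow> S = UNIV)"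

definition galois_group :: "('a::field \<Rightarrow> 'b::field) \<Rightarrow> ('b \<Rightarrow> 'b) monoid" where
  "galois_group \<phi> = \<lparr> carrier = {\<sigma>. bij \<sigma> \<and> is_field_hom \<sigma> \<and> (\<forall>a. \<sigma> (\<phi> a) = \<phi> a)},
                       mult = (\<circ>), one = id \<rparr>"

text \<open>Elements of R_n are represented by F_2-polynomials of degree < n.\<close>
definition Rn :: "nat \<Rightarrow> bit poly set" where
  "Rn n = {p. degree p < n}"

definition truncR :: "nat \<Rightarrow> bit poly \<Rightarrow> bit poly" where
  "truncR n p = (\<Sum>i<n. monom (coeff p i) i)"

definition mulR :: "nat \<Rightarrow> bit poly \<Rightarrow> bit poly \<Rightarrow> bit poly" where
  "mulR n p q = truncR n (p * q)"

definition unitsR :: "nat \<Rightarrow> bit poly set" where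
  "unitsR n = {u \<in> Rn n. \<exists>v \<in> Rn n. mulR n u v = 1}"

definition affine_group :: "nat \<Rightarrow> (bit poly \<Rightarrow> bit poly) monoid" where
  "affine_group n = \<lparr> carrier = {(\<lambda>v\<in>Rn n. mulR n u v + w) | u w. u \<in> unitsR n \<and> w \<in> Rn n},
                      mult = (\<lambda>f g. compose (Rn n) f g), one = (\<lambda>v\<in>Rn n. v) \<rparr>"

end

theory Submission
  imports Defs
begin

text \<open>
  With \<open>L(x) = x\<^sup>2 + s x\<close>, which is additive in characteristic 2, the roots of the \<open>n\<close>-th iterate form
  a torsor \<open>b + ker L\<^sup>n\<close>, and \<open>ker L\<^sup>n\<close> is a free \<open>R\<^sub>n\<close>-module of rank one with \<open>Y\<close> acting as \<open>L\<close>
  and a generator \<open>v\<close> such that \<open>L\<^bsup>n-1\<^esup>(v) = s\<close>. Automorphisms commute with \<open>L\<close>, so they act on the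
  torsor by affine maps.

  That every affine map occurs is a ramification argument. Put \<open>v\<^sub>i = L\<^bsup>n-i\<^esup>(v)\<close> and
  \<open>b\<^sub>i = G\<^bsup>n-i\<^esup>(b)\<close>, so that \<open>v\<^sub>1 = s\<close>, \<open>L(v\<^sub>i\<^sub>+\<^sub>1) = v\<^sub>i\<close>, \<open>b\<^sub>0 = 0\<close> and \<open>L(b\<^sub>i\<^sub>+\<^sub>1) = b\<^sub>i + t\<close>. The
  monomial valuation of \<open>k(s,t)\<close> with \<open>w(s) = 1\<close> and \<open>w(t) = \<surd>2\<close> has value group of rational rank 2, and
  along the tower \<open>v\<^sub>2, \<dots>, v\<^sub>n, b\<^sub>1, \<dots>, b\<^sub>n\<close> each new element has half the value of its image under \<open>L\<close>, which
  lies outside the value group reached so far. Hence every step is a proper quadratic extension, to which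
  the valuation extends and over which a homomorphism may be prolonged with either choice of root.
\<close>

section \<open>Valuations and quadratic extensions\<close>

definition field_hom_on :: "'a::field set \<Rightarrow> ('a \<Rightarrow> 'a) \<Rightarrow> bool" where
  "field_hom_on E \<tau> \<longleftrightarrow>
     (\<forall>x\<in>E. \<forall>y\<in>E. \<tau> (x + y) = \<tau> x + \<tau> y \<and> \<tau> (x * y) = \<tau> x * \<tau> y) \<and> \<tau> 1 = 1"

text \<open>The field E(a), once \<open>a\<close> is quadratic over \<open>E\<close>; see
  \<open>is_subfield_adjoin\<close>.\<close>

definition adjoin :: "'a::field set \<Rightarrow> 'a \<Rightarrow> 'a set" where
  "adjoin E a = {e + f * a | e f. e \<in> E \<and> f \<in> E}"

text \<open>Linear independence over the rationals, with denominators cleared.\<close>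

definition int_independent :: "real \<Rightarrow> real \<Rightarrow> bool" where
  "int_independent \<alpha> \<beta> \<longleftrightarrow> (\<forall>p q :: int. of_int p * \<alpha> + of_int q * \<beta> = 0 \<longrightarrow> p = 0 \<and> q = 0)"

text \<open>The value group is contained in \<open>\<int>\<alpha> + \<int>\<beta>\<close>; the value \<open>w 0\<close> is junk, hence the nonzero side conditions.\<close>

definition valuation_on :: "'a::field set \<Rightarrow> ('a \<Rightarrow> real) \<Rightarrow> real \<Rightarrow> real \<Rightarrow> bool" where
  "valuation_on E w \<alpha> \<beta> \<longleftrightarrow> is_subfield E
     \<and> (\<forall>x\<in>E. x \<noteq> 0 \<longrightarrow> (\<exists>p q :: int. w x = of_int p * \<alpha> + of_int q * \<beta>))
     \<and> (\<forall>x\<in>E. \<forall>y\<in>E. x \<noteq> 0 \<longrightarrow> y \<noteq> 0 \<longrightarrow> w (x * y) = w x + w y)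
     \<and> (\<forall>x\<in>E. \<forall>y\<in>E. x \<noteq> 0 \<longrightarrow> y \<noteq> 0 \<longrightarrow> x + y \<noteq> 0 \<longrightarrow> min (w x) (w y) \<le> w (x + y))"

lemma is_subfield_closed:
  assumes "is_subfield E"
  shows "0 \<in> E" "1 \<in> E" "x \<in> E \<Longrightarrow> y \<in> E \<Longrightarrow> x + y \<in> E" "x \<in> E \<Longrightarrow> y \<in> E \<Longrightarrow> x * y \<in> E"
    "x \<in> E \<Longrightarrow> - x \<in> E" "x \<in> E \<Longrightarrow> inverse x \<in> E"
  using assms by (auto simp: is_subfield_def)

lemma is_subfield_diff:
  assumes "is_subfield E" "x \<in> E" "y \<in> E"
  shows "x - y \<in> E"
  using is_subfield_closed(3)[OF assms(1,2) is_subfield_closed(5)[OF assms(1,3)]] by simp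

lemma field_hom_on_zero:
  assumes "field_hom_on E \<tau>" "0 \<in> E"
  shows "\<tau> 0 = 0"
proof -
  have "\<tau> (0 + 0) = \<tau> 0 + \<tau> 0" using assms unfolding field_hom_on_def by blast
  then show ?thesis by (metis add_0 add_right_imp_eq)
qed

lemma adjoin_coeffs_unique:
  assumes "is_subfield E" "a \<notin> E" "e \<in> E" "f \<in> E" "e' \<in> E" "f' \<in> E"
    and "e + f * a = e' + f' * a"
  shows "e = e' \<and> f = f'"
proof (cases "f = f'")
  case False
  have "a = (e' - e) * inverse (f - f')"
    using assms(7) False by (simp add: field_simps)
  moreover have "(e' - e) * inverse (f - f') \<in> E"
    using assms by (intro is_subfield_closed is_subfield_diff) auto
  ultimately show ?thesis using assms(2) by simp
qed (use assms(7) in auto)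

text \<open>Coordinates with respect to 1 and \<open>a\<close> are unique, so a function on E(a) can
  be prescribed through them. Homomorphisms and valuations are both extended in this way.\<close>

lemma adjoin_fun:
  assumes "is_subfield E" "a \<notin> E"
  obtains G where "\<And>e f. e \<in> E \<Longrightarrow> f \<in> E \<Longrightarrow> G (e + f * a) = F e f"
proof
  fix e f assume ef: "e \<in> E" "f \<in> E"
  let ?P = "\<lambda>z y. \<exists>e f. e \<in> E \<and> f \<in> E \<and> z = e + f * a \<and> y = F e f"
  show "(\<lambda>z. THE y. ?P z y) (e + f * a) = F e f"
  proof (rule the_equality)
    show "?P (e + f * a) (F e f)" using ef by blast
    fix y assume "?P (e + f * a) y"
    then show "y = F e f" using adjoin_coeffs_unique[OF assms ef] by blast
  qed
qed

lemma valuation_on_subfield: "valuation_on E w \<alpha> \<beta> \<Longrightarrow> is_subfield E"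
  by (simp add: valuation_on_def)

lemma valuation_on_mult:
  "valuation_on E w \<alpha> \<beta> \<Longrightarrow> x \<in> E \<Longrightarrow> y \<in> E \<Longrightarrow> x \<noteq> 0 \<Longrightarrow> y \<noteq> 0 \<Longrightarrow> w (x * y) = w x + w y"
  by (simp add: valuation_on_def)

text \<open>The threshold \<open>r\<close> with its clause for 0 mimics the convention that 0 has
  infinite value.\<close>

lemma valuation_on_add_ge:
  assumes "valuation_on E w \<alpha> \<beta>" "x \<in> E" "y \<in> E"
    and "x = 0 \<or> r \<le> w x" "y = 0 \<or> r \<le> w y"
  shows "x + y = 0 \<or> r \<le> w (x + y)"
proof (cases "x = 0 \<or> y = 0 \<or> x + y = 0")
  case False
  then have "min (w x) (w y) \<le> w (x + y)" using assms(1-3) unfolding valuation_on_def by blast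
  then show ?thesis using False assms(4,5) by linarith
qed (use assms in auto)

text \<open>The tower construction halves the first generator of the value group; exchanging the two
  lets it run a second time on the other one.\<close>

lemma valuation_on_swap:
  assumes "valuation_on E w \<alpha> \<beta>"
  shows "valuation_on E w \<beta> \<alpha>"
proof -
  have "\<exists>p q :: int. w x = of_int p * \<beta> + of_int q * \<alpha>" if x: "x \<in> E" "x \<noteq> 0" for x
  proof -
    obtain p q :: int where "w x = of_int p * \<alpha> + of_int q * \<beta>"
      using assms x unfolding valuation_on_def by blast
    then have "w x = of_int q * \<beta> + of_int p * \<alpha>" by simp
    then show ?thesis by blast
  qed
  then show ?thesis using assms unfolding valuation_on_def by blast
qed

lemma int_independent_swap: "int_independent \<alpha> \<beta> \<Longrightarrow> int_independent \<beta> \<alpha>"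
  unfolding int_independent_def by (simp only: add.commute[of "_ * \<beta>"]) blast

lemma int_independent_half:
  assumes "int_independent \<alpha> \<beta>"
  shows "int_independent (\<alpha> / 2) \<beta>"
  unfolding int_independent_def
proof (intro allI impI)
  fix p q :: int
  assume "of_int p * (\<alpha> / 2) + of_int q * \<beta> = 0"
  then have "of_int p * \<alpha> + of_int (2 * q) * \<beta> = 0" by simp
  then show "p = 0 \<and> q = 0" using assms unfolding int_independent_def by (metis mult_eq_0_iff zero_neq_numeral)
qed

text \<open>By independence the coefficient of \<alpha> would have to be one half. Properness of the
  quadratic extensions rests on this.\<close>

lemma half_not_in_value_group:
  assumes "int_independent \<alpha> \<beta>" "valuation_on E w \<alpha> \<beta>" "x \<in> E" "x \<noteq> 0"
  shows "w x \<noteq> \<alpha> / 2"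
proof
  assume a: "w x = \<alpha> / 2"
  obtain p q :: int where "w x = of_int p * \<alpha> + of_int q * \<beta>"
    using assms(2-4) unfolding valuation_on_def by blast
  with a have "of_int (2 * p - 1) * \<alpha> + of_int (2 * q) * \<beta> = 0" by (simp add: algebra_simps)
  then have "2 * p - 1 = 0" using assms(1) unfolding int_independent_def by blast
  then show False by presburger
qed

section \<open>Quadratic extensions by roots of a^2 + s a = c in characteristic 2\<close>

locale char2_field =
  fixes s :: "'a::field"
  assumes two_eq_0: "(2::'a) = 0" and s_nonzero: "s \<noteq> 0"
begin

lemma add_self [simp]: "x + x = (0::'a)"
  by (simp add: two_eq_0 flip: mult_2)

lemma uminus_eq [simp]: "- x = (x::'a)"
  by (rule minus_unique) simp

lemma add_self_left [simp]: "x + (x + y) = (y::'a)"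
  by (simp add: add.assoc[symmetric])

text \<open>The upper bound on the value of the sum is the ultrametric inequality for x = (x + y) +
  y, addition serving as subtraction in characteristic 2.\<close>

lemma valuation_on_add_less:
  fixes x y :: 'a
  assumes "valuation_on E w \<alpha> \<beta>" "x \<in> E" "y \<in> E" "x \<noteq> 0" "y = 0 \<or> w x < w y"
  shows "x + y \<noteq> 0 \<and> w (x + y) = w x"
proof (cases "y = 0")
  case False
  then have less: "w x < w y" using assms by simp
  have nz: "x + y \<noteq> 0" using less by (auto simp: add_eq_0_iff)
  have E: "x + y \<in> E" using is_subfield_closed(3)[OF valuation_on_subfield] assms by blast
  have "w x \<le> w (x + y)"
    using valuation_on_add_ge[OF assms(1-3), of "w x"] less nz by auto
  moreover have "min (w (x + y)) (w y) \<le> w x"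
    using valuation_on_add_ge[OF assms(1) E assms(3), of "min (w (x + y)) (w y)"] assms(4)
    by (auto simp: add.assoc)
  ultimately show ?thesis using less nz by auto
qed (use assms in auto)

text \<open>A Newton polygon argument on a (a + s) = c. If \<open>w a < w s\<close>, both factors
  have value \<alpha> / 2, which is not in the value group; otherwise both have value at least
  \<open>w s\<close>, and the product lies above \<alpha>.\<close>

lemma quadratic_root_notin:
  assumes val: "valuation_on E w \<alpha> \<beta>" and ind: "int_independent \<alpha> \<beta>"
    and "s \<in> E" "c \<in> E" "c \<noteq> 0" "w c = \<alpha>" "\<alpha> < 2 * w s" "a * a + s * a = c"
  shows "a \<notin> E"
proof
  assume aE: "a \<in> E"
  have c: "c = a * (a + s)" using assms(8) by (simp add: algebra_simps)
  then have nz: "a \<noteq> 0" "a + s \<noteq> 0" using assms(5) by auto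
  have sE: "a + s \<in> E" using is_subfield_closed(3)[OF valuation_on_subfield[OF val] aE assms(3)] .
  have sum: "w a + w (a + s) = \<alpha>" using valuation_on_mult[OF val aE sE nz] c assms(6) by simp
  show False
  proof (cases "w a < w s")
    case True
    then have "w (a + s) = w a" using valuation_on_add_less[OF val aE assms(3) nz(1)] by simp
    then have "w a = \<alpha> / 2" using sum by simp
    then show False using half_not_in_value_group[OF ind val aE nz(1)] by simp
  next
    case False
    then have "w s \<le> w (a + s)"
      using valuation_on_add_ge[OF val aE assms(3), of "w s"] nz by auto
    then show False using False sum assms(7) by simp
  qed
qed

text \<open>The norm of e + f a from E(a) down to \<open>E\<close> when a^2 + s a = c; the conjugate
  of \<open>a\<close> is a + s.\<close>

abbreviation quad_norm :: "'a \<Rightarrow> 'a \<Rightarrow> 'a \<Rightarrow> 'a" where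
  "quad_norm c e f \<equiv> e * e + s * e * f + f * f * c"

lemma quad_norm_eq:
  assumes "a * a + s * a = c"
  shows "quad_norm c e f = (e + f * a) * (e + f * s + f * a)"
proof -
  have "(e + f * a) * (e + f * s + f * a) = e * e + s * e * f + f * f * (a * a + s * a) + (e * f * a + e * f * a)"
    by (simp add: algebra_simps)
  then show ?thesis using assms by simp
qed

lemma quad_norm_nonzero:
  assumes "is_subfield E" "a \<notin> E" "a * a + s * a = c" "s \<in> E" "e \<in> E" "f \<in> E" "e + f * a \<noteq> 0"
  shows "quad_norm c e f \<noteq> 0"
proof -
  have "e + f * s + f * a \<noteq> 0"
  proof
    assume "e + f * s + f * a = 0"
    then have "(e + f * s) + f * a = 0 + 0 * a" by simp
    then have "e + f * s = 0 \<and> f = 0"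
      using adjoin_coeffs_unique[OF assms(1,2), of "e + f * s" f 0 0] assms is_subfield_closed[OF assms(1)]
      by blast
    then show False using assms(7) by auto
  qed
  then show ?thesis using assms by (simp add: quad_norm_eq)
qed

lemma is_subfield_adjoin:
  assumes "is_subfield E" "a \<notin> E" "a * a + s * a = c" "s \<in> E" "c \<in> E"
  shows "is_subfield (adjoin E a)"
proof -
  note cl = is_subfield_closed[OF assms(1)]
  have I: "z \<in> adjoin E a" if "z = e + f * a" "e \<in> E" "f \<in> E" for z e f
    using that unfolding adjoin_def by blast
  have "x + y \<in> adjoin E a \<and> x * y \<in> adjoin E a" if xy: "x \<in> adjoin E a" "y \<in> adjoin E a" for x y
  proof -
    obtain e f e' f' where ef: "x = e + f * a" "y = e' + f' * a" "e \<in> E" "f \<in> E" "e' \<in> E" "f' \<in> E"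
      using xy unfolding adjoin_def by auto
    have "x + y = (e + e') + (f + f') * a" using ef by (simp add: algebra_simps)
    \<comment> \<open>Reduction by a^2 = c + s a, with \<open>c\<close> written out so that only an
      identity modulo 2 remains.\<close>
    moreover have "x * y = (e * e' + f * f' * c) + (e * f' + f * e' + f * f' * s) * a"
      unfolding ef assms(3)[symmetric] by (simp add: algebra_simps)
    moreover have "e + e' \<in> E" "f + f' \<in> E" "e * e' + f * f' * c \<in> E" "e * f' + f * e' + f * f' * s \<in> E"
      using ef assms by (auto intro!: cl)
    ultimately show ?thesis using I by blast
  qed
  moreover have "inverse x \<in> adjoin E a" if "x \<in> adjoin E a" for x
  proof (cases "x = 0")
    case False
    obtain e f where ef: "x = e + f * a" "e \<in> E" "f \<in> E" using \<open>x \<in> adjoin E a\<close> unfolding adjoin_def by auto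
    let ?N = "quad_norm c e f"
    have nz: "?N \<noteq> 0" using quad_norm_nonzero[OF assms(1-4) ef(2,3)] ef False by blast
    \<comment> \<open>The inverse is the conjugate divided by the norm.\<close>
    have "x * ((e + f * s + f * a) * inverse ?N) = 1"
      unfolding ef mult.assoc[symmetric] quad_norm_eq[OF assms(3), symmetric] using nz by (rule right_inverse)
    then have "inverse x = (e + f * s + f * a) * inverse ?N" using inverse_unique by metis
    also have "\<dots> = ((e + f * s) * inverse ?N) + (f * inverse ?N) * a" by (simp add: algebra_simps)
    finally show ?thesis
    proof (rule I)
      have "inverse ?N \<in> E" using ef assms by (intro cl)
      then show "(e + f * s) * inverse ?N \<in> E" "f * inverse ?N \<in> E" using ef assms by (auto intro!: cl)
    qed
  next
    case True
    then have "inverse x = 0 + 0 * a" by simp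
    then show ?thesis using I cl by blast
  qed
  moreover have "0 \<in> adjoin E a" "1 \<in> adjoin E a" using I[of 0 0 0] I[of 1 1 0] cl by auto
  ultimately show ?thesis unfolding is_subfield_def by auto
qed

text \<open>E(a) is E[X] modulo X^2 + s X + c, so \<open>a\<close> may be sent to any root of the
  image polynomial in the ambient field.\<close>

lemma field_hom_on_adjoin:
  assumes E: "is_subfield E" "a \<notin> E" "a * a + s * a = c" "s \<in> E" "c \<in> E"
    and \<tau>: "field_hom_on E \<tau>" "\<tau> s = s" "a' * a' + s * a' = \<tau> c"
  shows "\<exists>\<tau>'. field_hom_on (adjoin E a) \<tau>' \<and> (\<forall>y\<in>E. \<tau>' y = \<tau> y) \<and> \<tau>' a = a'"
proof -
  note cl = is_subfield_closed[OF E(1)]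
  have h: "\<tau> (x + y) = \<tau> x + \<tau> y" "\<tau> (x * y) = \<tau> x * \<tau> y" if "x \<in> E" "y \<in> E" for x y
    using \<tau>(1) that by (auto simp: field_hom_on_def)
  have h0: "\<tau> 0 = 0" "\<tau> 1 = 1" using \<tau>(1) field_hom_on_zero cl by (auto simp: field_hom_on_def)
  obtain \<tau>' where t': "\<And>e f. e \<in> E \<Longrightarrow> f \<in> E \<Longrightarrow> \<tau>' (e + f * a) = \<tau> e + \<tau> f * a'"
    using adjoin_fun[OF E(1,2), of "\<lambda>e f. \<tau> e + \<tau> f * a'"] by metis
  have ext: "\<tau>' y = \<tau> y" if "y \<in> E" for y using t'[of y 0] that cl h0 by simp
  have "\<tau>' (x + y) = \<tau>' x + \<tau>' y \<and> \<tau>' (x * y) = \<tau>' x * \<tau>' y"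
    if xy: "x \<in> adjoin E a" "y \<in> adjoin E a" for x y
  proof
    obtain e f e' f' where ef: "x = e + f * a" "y = e' + f' * a" "e \<in> E" "f \<in> E" "e' \<in> E" "f' \<in> E"
      using xy unfolding adjoin_def by auto
    have "x + y = (e + e') + (f + f') * a" using ef by (simp add: algebra_simps)
    then have "\<tau>' (x + y) = \<tau> (e + e') + \<tau> (f + f') * a'"
      using ef by (simp only:) (intro t' cl; assumption)
    then show "\<tau>' (x + y) = \<tau>' x + \<tau>' y" unfolding ef(1,2) using ef(3-6)
      by (simp only: t' h) (simp add: algebra_simps)
    have "x * y = (e * e' + f * f' * c) + (e * f' + f * e' + f * f' * s) * a"
      unfolding ef E(3)[symmetric] by (simp add: algebra_simps)
    then have "\<tau>' (x * y) = \<tau> (e * e' + f * f' * c) + \<tau> (e * f' + f * e' + f * f' * s) * a'"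
      using ef E by (simp only:) (intro t' cl; assumption)
    also have "\<dots> = (\<tau> e * \<tau> e' + \<tau> f * \<tau> f' * (a' * a' + s * a')) + (\<tau> e * \<tau> f' + \<tau> f * \<tau> e' + \<tau> f * \<tau> f' * s) * a'"
      using ef cl E \<tau> by (simp add: h)
    also have "\<dots> = (\<tau> e + \<tau> f * a') * (\<tau> e' + \<tau> f' * a')" by (simp add: algebra_simps)
    finally show "\<tau>' (x * y) = \<tau>' x * \<tau>' y" using ef by (simp add: t')
  qed
  moreover have "\<tau>' a = a'" using t'[of 0 1] cl h0 by simp
  moreover have "\<tau>' 1 = 1" using ext[OF cl(2)] h0 by simp
  ultimately have "field_hom_on (adjoin E a) \<tau>'" unfolding field_hom_on_def by blast
  then show ?thesis using ext \<open>\<tau>' a = a'\<close> by blast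
qed

text \<open>The values of e^2 and f^2 c differ, since \<alpha> / 2 is not in the value group, and
  that of s e f exceeds their mean by w s - \<alpha> / 2 > 0. So the norm has twice the value min (w
  e, w f + \<alpha> / 2); the threshold form also covers e = 0 and f = 0.\<close>

lemma valuation_on_quad_norm_ge_iff:
  assumes val: "valuation_on E w \<alpha> \<beta>" and ind: "int_independent \<alpha> \<beta>"
    and E: "s \<in> E" "c \<in> E" "c \<noteq> 0" "w c = \<alpha>" "\<alpha> < 2 * w s" and ef: "e \<in> E" "f \<in> E"
    and nz: "e \<noteq> 0 \<or> f \<noteq> 0"
  shows "2 * r \<le> w (quad_norm c e f) \<longleftrightarrow> (e = 0 \<or> r \<le> w e) \<and> (f = 0 \<or> r - \<alpha> / 2 \<le> w f)"
proof -
  note cl = is_subfield_closed[OF valuation_on_subfield[OF val]]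
  note wm = valuation_on_mult[OF val]
  have wf: "w (f * f * c) = 2 * w f + \<alpha>" if "f \<noteq> 0" using that E ef cl by (simp add: wm)
  have we: "w (e * e) = 2 * w e" if "e \<noteq> 0" using that ef by (simp add: wm)
  consider "e = 0" | "f = 0" | "e \<noteq> 0" "f \<noteq> 0" by blast
  then show ?thesis
  proof cases
    case 1 then show ?thesis using wf nz by (auto simp: field_simps)
  next
    case 2 then show ?thesis using we nz by auto
  next
    case 3
    have ws: "w (s * e * f) = w s + w e + w f" using 3 E ef cl s_nonzero by (simp add: wm)
    have ne: "2 * w e \<noteq> 2 * w f + \<alpha>"
    proof
      assume "2 * w e = 2 * w f + \<alpha>"
      moreover have "w f + w (e * inverse f) = w e"
        using wm[of f "e * inverse f"] 3 ef cl by (simp add: mult.left_commute[of f])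
      ultimately have "w (e * inverse f) = \<alpha> / 2" by simp
      then show False using half_not_in_value_group[OF ind val, of "e * inverse f"] 3 ef cl by auto
    qed
    have mem: "e * e \<in> E" "s * e * f \<in> E" "f * f * c \<in> E" "f * f * c + s * e * f \<in> E"
      "e * e + s * e * f \<in> E" using ef E cl by auto
    have "w (quad_norm c e f) = min (2 * w e) (2 * w f + \<alpha>)"
    proof (cases "2 * w e < 2 * w f + \<alpha>")
      case True
      have "w (e * e) < w (s * e * f)" unfolding we[OF 3(1)] ws using True E(5) by linarith
      then have *: "e * e + s * e * f \<noteq> 0 \<and> w (e * e + s * e * f) = 2 * w e"
        using valuation_on_add_less[OF val mem(1,2)] 3(1) we[OF 3(1)] by simp
      then have "w (quad_norm c e f) = 2 * w e"
        using valuation_on_add_less[OF val mem(5,3)] True wf[OF 3(2)] by simp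
      then show ?thesis using True by linarith
    next
      case False
      have "w (f * f * c) < w (s * e * f)" unfolding wf[OF 3(2)] ws using False ne E(5) by linarith
      then have *: "f * f * c + s * e * f \<noteq> 0 \<and> w (f * f * c + s * e * f) = 2 * w f + \<alpha>"
        using valuation_on_add_less[OF val mem(3,2)] 3(2) E(3) wf[OF 3(2)] by simp
      have "w (f * f * c + s * e * f) < w (e * e)" unfolding we[OF 3(1)] using * False ne by linarith
      then have "w (f * f * c + s * e * f + e * e) = 2 * w f + \<alpha>"
        using valuation_on_add_less[OF val mem(4,1)] * by metis
      moreover have "quad_norm c e f = f * f * c + s * e * f + e * e" by (simp only: add_ac)
      ultimately have "w (quad_norm c e f) = 2 * w f + \<alpha>" by metis
      then show ?thesis using False by linarith
    qed
    then have "2 * r \<le> w (quad_norm c e f) \<longleftrightarrow> 2 * r \<le> 2 * w e \<and> 2 * r \<le> 2 * w f + \<alpha>" by linarith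
    also have "\<dots> \<longleftrightarrow> r \<le> w e \<and> r - \<alpha> / 2 \<le> w f" by linarith
    finally show ?thesis using 3 by blast
  qed
qed

text \<open>The extension is half the value of the norm. Multiplicativity comes from the norm; the
  description as min (w e, w f + \<alpha> / 2) gives the ultrametric inequality and the new value
  group.\<close>

lemma valuation_on_adjoin:
  assumes val: "valuation_on E w \<alpha> \<beta>" and ind: "int_independent \<alpha> \<beta>"
    and E: "s \<in> E" "c \<in> E" "c \<noteq> 0" "w c = \<alpha>" "\<alpha> < 2 * w s" and a: "a * a + s * a = c"
  shows "\<exists>w'. valuation_on (adjoin E a) w' (\<alpha> / 2) \<beta> \<and> (\<forall>y\<in>E. y \<noteq> 0 \<longrightarrow> w' y = w y) \<and> w' a = \<alpha> / 2"
proof -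
  note sub = valuation_on_subfield[OF val]
  note cl = is_subfield_closed[OF sub]
  note wm = valuation_on_mult[OF val]
  have aE: "a \<notin> E" using quadratic_root_notin[OF val ind E a] .
  obtain w' where w': "\<And>e f. e \<in> E \<Longrightarrow> f \<in> E \<Longrightarrow> w' (e + f * a) = w (quad_norm c e f) / 2"
    using adjoin_fun[OF sub aE, of "\<lambda>e f. w (quad_norm c e f) / 2"] by metis
  have NE: "quad_norm c e f \<in> E" if "e \<in> E" "f \<in> E" for e f using that E cl by auto
  have ext: "w' y = w y" if "y \<in> E" "y \<noteq> 0" for y using w'[of y 0] that cl by (simp add: wm)
  have wa: "w' a = \<alpha> / 2" using w'[of 0 1] cl E by simp
  have ge: "r \<le> w' (e + f * a) \<longleftrightarrow> (e = 0 \<or> r \<le> w e) \<and> (f = 0 \<or> r - \<alpha> / 2 \<le> w f)"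
    if "e \<in> E" "f \<in> E" "e + f * a \<noteq> 0" for e f r
  proof -
    have "e \<noteq> 0 \<or> f \<noteq> 0" using that(3) by auto
    from valuation_on_quad_norm_ge_iff[OF val ind E that(1,2) this, of r] show ?thesis
      unfolding w'[OF that(1,2)] by linarith
  qed
  have grp: "\<exists>p q :: int. w' x = of_int p * (\<alpha> / 2) + of_int q * \<beta>"
    if x: "x \<in> adjoin E a" "x \<noteq> 0" for x
  proof -
    obtain e f where ef: "x = e + f * a" "e \<in> E" "f \<in> E" using x unfolding adjoin_def by auto
    define m where "m = w' x"
    have "(e = 0 \<or> m \<le> w e) \<and> (f = 0 \<or> m - \<alpha> / 2 \<le> w f)"
      using ge[OF ef(2,3), of m] ef x m_def by simp
    \<comment> \<open>The minimum is attained: if both inequalities were strict, a threshold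
      \<open>r\<close> above \<open>m\<close> would still be met. The entry m + 1 stands in for
      infinity at a vanishing coefficient.\<close>
    moreover have "\<not> ((e = 0 \<or> m < w e) \<and> (f = 0 \<or> m - \<alpha> / 2 < w f))"
    proof
      assume A: "(e = 0 \<or> m < w e) \<and> (f = 0 \<or> m - \<alpha> / 2 < w f)"
      define r where "r = min (if e = 0 then m + 1 else w e) (if f = 0 then m + 1 else w f + \<alpha> / 2)"
      have "m < r" using A by (auto simp: r_def)
      moreover have "r \<le> m" using ge[OF ef(2,3), of r] ef x m_def by (auto simp: r_def min_def)
      ultimately show False by simp
    qed
    ultimately consider "e \<noteq> 0" "m = w e" | "f \<noteq> 0" "m = w f + \<alpha> / 2" by fastforce
    then show ?thesis
    proof cases
      case 1
      obtain p q :: int where "w e = of_int p * \<alpha> + of_int q * \<beta>"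
        using val ef 1 unfolding valuation_on_def by blast
      then have "w' x = of_int (2 * p) * (\<alpha> / 2) + of_int q * \<beta>" using 1 m_def by simp
      then show ?thesis by blast
    next
      case 2
      obtain p q :: int where "w f = of_int p * \<alpha> + of_int q * \<beta>"
        using val ef 2 unfolding valuation_on_def by blast
      then have "w' x = of_int (2 * p + 1) * (\<alpha> / 2) + of_int q * \<beta>" using 2 m_def by (simp add: field_simps)
      then show ?thesis by blast
    qed
  qed
  have mult: "w' (x * y) = w' x + w' y"
    if xy: "x \<in> adjoin E a" "y \<in> adjoin E a" "x \<noteq> 0" "y \<noteq> 0" for x y
  proof -
    obtain e f e' f' where ef: "x = e + f * a" "y = e' + f' * a" "e \<in> E" "f \<in> E" "e' \<in> E" "f' \<in> E"
      using xy unfolding adjoin_def by auto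
    let ?g = "e * e' + f * f' * c" and ?h = "e * f' + f * e' + f * f' * s"
    have p: "x * y = ?g + ?h * a"
      unfolding ef a[symmetric] by (simp add: algebra_simps)
    \<comment> \<open>Conjugation is multiplicative, hence so is the norm.\<close>
    have conj: "?g + ?h * s + ?h * a = (e + f * s + f * a) * (e' + f' * s + f' * a)"
    proof -
      have "(e + f * s + f * a) * (e' + f' * s + f' * a) =
         e * e' + f * f' * (a * a + s * a) + ?h * s + ?h * a" by (simp add: algebra_simps)
      then show ?thesis using a by simp
    qed
    have "quad_norm c ?g ?h = quad_norm c e f * quad_norm c e' f'"
      unfolding quad_norm_eq[OF a] conj p[symmetric] using ef(1,2) by (simp add: mult_ac)
    moreover have "quad_norm c e f \<noteq> 0" "quad_norm c e' f' \<noteq> 0"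
      using quad_norm_nonzero[OF sub aE a E(1)] ef xy by auto
    ultimately have "w (quad_norm c ?g ?h) = w (quad_norm c e f) + w (quad_norm c e' f')"
      using wm NE ef by metis
    moreover have "w' (x * y) = w (quad_norm c ?g ?h) / 2"
      unfolding p using ef cl E by (intro w') auto
    ultimately show ?thesis using ef by (simp add: w')
  qed
  have ultra: "min (w' x) (w' y) \<le> w' (x + y)"
    if xy: "x \<in> adjoin E a" "y \<in> adjoin E a" "x \<noteq> 0" "y \<noteq> 0" "x + y \<noteq> 0" for x y
  proof -
    obtain e f e' f' where ef: "x = e + f * a" "y = e' + f' * a" "e \<in> E" "f \<in> E" "e' \<in> E" "f' \<in> E"
      using xy unfolding adjoin_def by auto
    define m where "m = min (w' x) (w' y)"
    have p: "x + y = (e + e') + (f + f') * a" using ef by (simp add: algebra_simps)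
    have "m \<le> w' x" "m \<le> w' y" by (auto simp: m_def)
    then have "(e = 0 \<or> m \<le> w e) \<and> (f = 0 \<or> m - \<alpha> / 2 \<le> w f)"
      "(e' = 0 \<or> m \<le> w e') \<and> (f' = 0 \<or> m - \<alpha> / 2 \<le> w f')"
      using ge[OF ef(3,4), of m] ge[OF ef(5,6), of m] xy(3,4) unfolding ef(1,2) by blast+
    then have "e + e' = 0 \<or> m \<le> w (e + e')" "f + f' = 0 \<or> m - \<alpha> / 2 \<le> w (f + f')"
      using valuation_on_add_ge[OF val ef(3,5), of m] valuation_on_add_ge[OF val ef(4,6), of "m - \<alpha> / 2"]
      by blast+
    moreover have "e + e' \<in> E" "f + f' \<in> E" using ef cl by auto
    ultimately have "m \<le> w' (x + y)" using ge[of "e + e'" "f + f'" m] xy(5) unfolding p by blast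
    then show ?thesis by (simp add: m_def)
  qed
  have "valuation_on (adjoin E a) w' (\<alpha> / 2) \<beta>"
    using is_subfield_adjoin[OF sub aE a E(1,2)] grp mult ultra unfolding valuation_on_def by blast
  then show ?thesis using ext wa by blast
qed

text \<open>The shift \<open>d\<close> lets one tower serve both for \<open>x\<^sub>i = v\<^sub>i\<^sub>+\<^sub>1\<close> (with \<open>d = 0\<close>) and for \<open>x\<^sub>i = b\<^sub>i + t\<close> (with \<open>d = t\<close>).\<close>

definition homs_extend :: "'a set \<Rightarrow> 'a set \<Rightarrow> (nat \<Rightarrow> 'a) \<Rightarrow> 'a \<Rightarrow> nat \<Rightarrow> bool" where
  "homs_extend E E' x d k \<longleftrightarrow>
     (\<forall>\<tau> x'. field_hom_on E \<tau> \<longrightarrow> \<tau> s = s \<longrightarrow> \<tau> d = d \<longrightarrow> \<tau> (x 0) = x' 0 \<longrightarrow>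
        (\<forall>i<k. (x' (Suc i) + d) * (x' (Suc i) + d) + s * (x' (Suc i) + d) = x' i) \<longrightarrow>
        (\<exists>\<tau>'. field_hom_on E' \<tau>' \<and> (\<forall>y\<in>E. \<tau>' y = \<tau> y) \<and> (\<forall>i\<le>k. \<tau>' (x i) = x' i)))"

text \<open>Induction on \<open>k\<close>: a = x (k + 1) + d solves a^2 + s a = x k, whose value
  \<alpha> / 2^k is still below 2 w s, so one more adjunction halves it again. The bound on
  \<open>d\<close> gives x (k + 1) the same value as \<open>a\<close>.\<close>

lemma quadratic_tower:
  assumes val: "valuation_on E w \<alpha> \<beta>" and ind: "int_independent \<alpha> \<beta>"
    and E: "s \<in> E" "\<alpha> < 2 * w s" "0 < \<alpha>" "x 0 \<in> E" "x 0 \<noteq> 0" "w (x 0) = \<alpha>"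
      "d \<in> E" "d = 0 \<or> \<alpha> \<le> w d"
    and "\<And>i. i < k \<Longrightarrow> (x (Suc i) + d) * (x (Suc i) + d) + s * (x (Suc i) + d) = x i"
  shows "\<exists>E' w'. valuation_on E' w' (\<alpha> / 2 ^ k) \<beta> \<and> int_independent (\<alpha> / 2 ^ k) \<beta>
     \<and> E \<subseteq> E' \<and> (\<forall>y\<in>E. y \<noteq> 0 \<longrightarrow> w' y = w y)
     \<and> (\<forall>i\<le>k. x i \<in> E') \<and> x k \<noteq> 0 \<and> w' (x k) = \<alpha> / 2 ^ k
     \<and> homs_extend E E' x d k"
  using assms(11)
proof (induction k)
  case 0
  show ?case
    using val ind E by (intro exI[of _ E] exI[of _ w]) (auto simp: homs_extend_def)
next
  case (Suc k)
  define \<delta> where "\<delta> = \<alpha> / 2 ^ k"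
  define a where "a = x (Suc k) + d"
  obtain E' w' where val': "valuation_on E' w' \<delta> \<beta>" and ind': "int_independent \<delta> \<beta>"
    and sub: "E \<subseteq> E'" and ext: "\<And>y. y \<in> E \<Longrightarrow> y \<noteq> 0 \<Longrightarrow> w' y = w y"
    and mem: "\<And>i. i \<le> k \<Longrightarrow> x i \<in> E'" and nz: "x k \<noteq> 0" and wk: "w' (x k) = \<delta>"
    and hom: "homs_extend E E' x d k"
    using Suc unfolding \<delta>_def by fastforce
  have a: "a * a + s * a = x k" using Suc.prems[of k] by (simp add: a_def)
  have d1: "\<delta> \<le> \<alpha>" "0 < \<delta>" using E(3) by (auto simp: \<delta>_def field_simps)
  have s': "s \<in> E'" "d \<in> E'" "\<delta> < 2 * w' s" using E sub d1 ext s_nonzero by auto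
  note step = val' ind' s'(1) mem[OF le_refl] nz wk s'(3) a
  obtain w'' where val'': "valuation_on (adjoin E' a) w'' (\<delta> / 2) \<beta>"
    and ext'': "\<And>y. y \<in> E' \<Longrightarrow> y \<noteq> 0 \<Longrightarrow> w'' y = w' y" and wa: "w'' a = \<delta> / 2"
    using valuation_on_adjoin[OF step] by blast
  have aE: "a \<notin> E'" using quadratic_root_notin[OF step] .
  note sf' = valuation_on_subfield[OF val']
  note cl = is_subfield_closed[OF valuation_on_subfield[OF val'']]
  note cl' = is_subfield_closed[OF sf']
  have "y + 0 * a \<in> adjoin E' a" if "y \<in> E'" for y using that cl' unfolding adjoin_def by blast
  then have sub': "E' \<subseteq> adjoin E' a" by auto
  have "0 + 1 * a \<in> adjoin E' a" using cl' unfolding adjoin_def by blast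
  then have aA: "a \<in> adjoin E' a" by simp
  have xa: "x (Suc k) = a + d" by (simp add: a_def add.assoc)
  have "w'' d = w d" if "d \<noteq> 0" using that ext ext'' s' E(7) by metis
  then have "d = 0 \<or> w'' a < w'' d" using E(8) wa d1 by force
  moreover have "a \<noteq> 0" using aE cl' by auto
  ultimately have last: "x (Suc k) \<noteq> 0 \<and> w'' (x (Suc k)) = \<delta> / 2"
    using valuation_on_add_less[OF val'' aA, of d] s' sub' xa wa by auto
  have mem'': "x i \<in> adjoin E' a" if "i \<le> Suc k" for i
    using that xa aA s' sub' cl mem by (cases "i = Suc k") auto
  have "homs_extend E (adjoin E' a) x d (Suc k)"
    unfolding homs_extend_def
  proof (intro allI impI)
    fix \<tau> x' assume \<tau>: "field_hom_on E \<tau>" "\<tau> s = s" "\<tau> d = d" "\<tau> (x 0) = x' 0"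
      and x': "\<forall>i<Suc k. (x' (Suc i) + d) * (x' (Suc i) + d) + s * (x' (Suc i) + d) = x' i"
    then obtain \<tau>' where \<tau>': "field_hom_on E' \<tau>'" "\<forall>y\<in>E. \<tau>' y = \<tau> y" "\<forall>i\<le>k. \<tau>' (x i) = x' i"
      using hom unfolding homs_extend_def by (metis less_SucI)
    have "(x' (Suc k) + d) * (x' (Suc k) + d) + s * (x' (Suc k) + d) = \<tau>' (x k)"
      using x' \<tau>'(3) by simp
    \<comment> \<open>The image of \<open>a\<close> is the prescribed image plus \<open>d\<close>;
      as \<open>d\<close> is fixed, x (k + 1) = a + d goes where it should.\<close>
    then obtain \<tau>'' where \<tau>'': "field_hom_on (adjoin E' a) \<tau>''" "\<forall>y\<in>E'. \<tau>'' y = \<tau>' y"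
      "\<tau>'' a = x' (Suc k) + d"
      using field_hom_on_adjoin[OF sf' aE a s'(1) mem[OF le_refl] \<tau>'(1)] \<tau>' \<tau> E(1) by metis
    have "\<tau>'' d = d" using \<tau>'' \<tau>' \<tau> s' E by auto
    then have "\<tau>'' (x (Suc k)) = x' (Suc k)"
      using \<tau>''(1,3) aA s' sub' unfolding xa field_hom_on_def by (auto simp: add.assoc)
    then have "\<forall>i\<le>Suc k. \<tau>'' (x i) = x' i" using \<tau>'' \<tau>' mem by (auto simp: le_Suc_eq)
    then show "\<exists>\<tau>'. field_hom_on (adjoin E' a) \<tau>' \<and> (\<forall>y\<in>E. \<tau>' y = \<tau> y) \<and> (\<forall>i\<le>Suc k. \<tau>' (x i) = x' i)"
      using \<tau>'' \<tau>' sub by (intro exI[of _ \<tau>'']) auto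
  qed
  moreover have eq: "\<alpha> / 2 ^ Suc k = \<delta> / 2" by (simp add: \<delta>_def)
  moreover have "\<forall>y\<in>E. y \<noteq> 0 \<longrightarrow> w'' y = w y" using ext ext'' sub by auto
  ultimately show ?case
    unfolding eq using val'' int_independent_half[OF ind'] sub sub' mem'' last
    by (intro exI[of _ "adjoin E' a"] exI[of _ w'']) auto
qed

end

section \<open>The monomial valuation on \<open>k(s,t)\<close>\<close>

text \<open>The outer variable is t and the inner one s, so \<open>coeff (coeff P j) i\<close>
  belongs to s^i t^j, a monomial of this value.\<close>

abbreviation monomial_weight :: "nat \<Rightarrow> nat \<Rightarrow> real" where
  "monomial_weight i j \<equiv> real i + real j * sqrt 2"

definition poly_weight :: "'k::field poly poly \<Rightarrow> real" where
  "poly_weight P = Min {monomial_weight i j | i j. coeff (coeff P j) i \<noteq> 0}"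

text \<open>Independence of the representing fraction is \<open>fract_weight_Fract\<close>. The
  value at 0 is junk, which \<open>valuation_on\<close> allows.\<close>

definition fract_weight :: "'k::field rat2 \<Rightarrow> real" where
  "fract_weight x =
     (THE r. \<exists>P Q. P \<noteq> 0 \<and> Q \<noteq> 0 \<and> x = Fract P Q \<and> r = poly_weight P - poly_weight Q)"

lemma int_independent_1_sqrt_2: "int_independent 1 (sqrt 2)"
  unfolding int_independent_def
proof (intro allI impI)
  fix p q :: int
  assume "of_int p * 1 + of_int q * sqrt 2 = 0"
  then have "of_int p = - (of_int q * sqrt 2)" by simp
  then have "(of_int p :: real)\<^sup>2 = (of_int q * sqrt 2)\<^sup>2" by simp
  then have "(of_int p :: real)\<^sup>2 = 2 * (of_int q)\<^sup>2" by (simp add: power_mult_distrib)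
  then have "(of_int (p\<^sup>2) :: real) = of_int (2 * q\<^sup>2)" by simp
  then have eq: "p\<^sup>2 = 2 * q\<^sup>2" by (simp only: of_int_eq_iff)
  show "p = 0 \<and> q = 0"
  proof (rule ccontr)
    assume "\<not> (p = 0 \<and> q = 0)"
    then have nz: "p \<noteq> 0" "q \<noteq> 0" using eq by auto
    have pr: "prime_elem (2::int)" by simp
    \<comment> \<open>The exponent of 2 is even in p^2 and odd in 2 q^2.\<close>
    have "multiplicity 2 (p\<^sup>2) = 2 * multiplicity 2 p"
      using nz by (intro prime_elem_multiplicity_power_distrib[OF pr])
    moreover have "multiplicity 2 (2 * q\<^sup>2) = 1 + 2 * multiplicity 2 q"
      using nz prime_elem_multiplicity_mult_distrib[OF pr, of 2 "q\<^sup>2"]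
        prime_elem_multiplicity_power_distrib[OF pr nz(2), of 2] by simp
    ultimately have "2 * multiplicity 2 p = 1 + 2 * multiplicity 2 q" unfolding eq by (rule trans[OF sym])
    then show False by presburger
  qed
qed

text \<open>Irrationality separates monomials: the least weight in a polynomial belongs to just one
  of them, which makes \<open>poly_weight\<close> multiplicative.\<close>

lemma monomial_weight_inj:
  assumes "monomial_weight i j = monomial_weight i' j'"
  shows "i = i' \<and> j = j'"
proof -
  have "of_int (int i - int i') * 1 + of_int (int j - int j') * sqrt 2 = 0"
    using assms by (simp add: algebra_simps)
  then have "int i - int i' = 0 \<and> int j - int j' = 0"
    using int_independent_1_sqrt_2 unfolding int_independent_def by blast
  then show ?thesis by simp
qed

lemma finite_weights: "finite {monomial_weight i j | i j. coeff (coeff P j) i \<noteq> 0}"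
proof (rule finite_subset)
  show "{monomial_weight i j | i j. coeff (coeff P j) i \<noteq> 0}
    \<subseteq> (\<Union>j\<le>degree P. (\<lambda>i. monomial_weight i j) ` {..degree (coeff P j)})"
  proof
    fix r assume "r \<in> {monomial_weight i j | i j. coeff (coeff P j) i \<noteq> 0}"
    then obtain i j where r: "r = monomial_weight i j" "coeff (coeff P j) i \<noteq> 0" by blast
    then have "coeff P j \<noteq> 0" by auto
    then have "j \<le> degree P" "i \<le> degree (coeff P j)" using r by (auto intro: le_degree)
    then show "r \<in> (\<Union>j\<le>degree P. (\<lambda>i. monomial_weight i j) ` {..degree (coeff P j)})" using r by auto
  qed
qed auto

lemma poly_weight_le: "coeff (coeff P j) i \<noteq> 0 \<Longrightarrow> poly_weight P \<le> monomial_weight i j"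
  unfolding poly_weight_def by (rule Min_le[OF finite_weights]) blast

lemma poly_weight_attained:
  assumes "P \<noteq> 0"
  obtains i j where "coeff (coeff P j) i \<noteq> 0" "poly_weight P = monomial_weight i j"
proof -
  have "coeff (coeff P (degree P)) (degree (coeff P (degree P))) \<noteq> 0" using assms by simp
  then have "{monomial_weight i j | i j. coeff (coeff P j) i \<noteq> 0} \<noteq> {}" by blast
  from Min_in[OF finite_weights this] show ?thesis using that unfolding poly_weight_def by auto
qed

lemma poly_weight_eqI:
  assumes "coeff (coeff P j) i \<noteq> 0"
    and "\<And>i' j'. coeff (coeff P j') i' \<noteq> 0 \<Longrightarrow> monomial_weight i j \<le> monomial_weight i' j'"
  shows "poly_weight P = monomial_weight i j"
proof -
  have "P \<noteq> 0" using assms(1) by auto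
  then obtain i' j' where "coeff (coeff P j') i' \<noteq> 0" "poly_weight P = monomial_weight i' j'"
    by (rule poly_weight_attained)
  then show ?thesis using assms poly_weight_le[OF assms(1)] by fastforce
qed

lemma coeff_coeff_mult:
  "coeff (coeff (P * Q) n) m =
     (\<Sum>(j, i)\<in>{..n} \<times> {..m}. coeff (coeff P j) i * coeff (coeff Q (n - j)) (m - i))"
  by (simp add: coeff_mult coeff_sum sum.cartesian_product)

text \<open>As for leading terms: the product of the two monomials of least weight arises from only
  one pair, so its coefficient cannot cancel.\<close>

lemma poly_weight_mult:
  assumes "P \<noteq> 0" "Q \<noteq> 0"
  shows "poly_weight (P * Q) = poly_weight P + poly_weight Q"
proof -
  obtain i0 j0 where P: "coeff (coeff P j0) i0 \<noteq> 0" "poly_weight P = monomial_weight i0 j0"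
    using poly_weight_attained[OF assms(1)] by blast
  obtain i1 j1 where Q: "coeff (coeff Q j1) i1 \<noteq> 0" "poly_weight Q = monomial_weight i1 j1"
    using poly_weight_attained[OF assms(2)] by blast
  let ?t = "\<lambda>n m (j, i). coeff (coeff P j) i * coeff (coeff Q (n - j)) (m - i)"
  have *: "monomial_weight i0 j0 \<le> monomial_weight i j \<and> monomial_weight i1 j1 \<le> monomial_weight (m - i) (n - j)
      \<and> monomial_weight i j + monomial_weight (m - i) (n - j) = monomial_weight m n"
    if "?t n m (j, i) \<noteq> 0" "i \<le> m" "j \<le> n" for n m i j
    using that poly_weight_le[of P j i] poly_weight_le[of Q "n - j" "m - i"] P Q
    by (auto simp: of_nat_diff algebra_simps)
  have "coeff (coeff (P * Q) (j0 + j1)) (i0 + i1) = ?t (j0 + j1) (i0 + i1) (j0, i0)"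
    unfolding coeff_coeff_mult
  proof (rule sum.remove[where x = "(j0, i0)", THEN trans])
    have "?t (j0 + j1) (i0 + i1) x = 0" if x: "x \<in> {..j0 + j1} \<times> {..i0 + i1} - {(j0, i0)}" for x
    proof (rule ccontr)
      obtain j i where ji: "x = (j, i)" by (cases x)
      assume "?t (j0 + j1) (i0 + i1) x \<noteq> 0"
      then have "monomial_weight i0 j0 \<le> monomial_weight i j \<and> monomial_weight i1 j1 \<le> monomial_weight (i0 + i1 - i) (j0 + j1 - j)
        \<and> monomial_weight i j + monomial_weight (i0 + i1 - i) (j0 + j1 - j) = monomial_weight (i0 + i1) (j0 + j1)"
        using *[of "j0 + j1" "i0 + i1" j i] x ji by simp
      moreover have "monomial_weight (i0 + i1) (j0 + j1) = monomial_weight i0 j0 + monomial_weight i1 j1"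
        by (simp add: algebra_simps)
      \<comment> \<open>Two weights bounded below by the minima and adding up to their sum must
        equal the minima.\<close>
      ultimately have "monomial_weight i j = monomial_weight i0 j0" by linarith
      then show False using monomial_weight_inj x ji by blast
    qed
    then show "?t (j0 + j1) (i0 + i1) (j0, i0) + sum (?t (j0 + j1) (i0 + i1)) ({..j0 + j1} \<times> {..i0 + i1} - {(j0, i0)}) =
      ?t (j0 + j1) (i0 + i1) (j0, i0)" by (simp add: sum.neutral)
  qed auto
  then have nz: "coeff (coeff (P * Q) (j0 + j1)) (i0 + i1) \<noteq> 0" using P Q by simp
  have "monomial_weight (i0 + i1) (j0 + j1) \<le> monomial_weight m n" if "coeff (coeff (P * Q) n) m \<noteq> 0" for m n
  proof -
    have "\<not> (\<forall>x\<in>{..n} \<times> {..m}. ?t n m x = 0)"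
      using that sum.neutral[of "{..n} \<times> {..m}" "?t n m"] unfolding coeff_coeff_mult by blast
    then obtain x where x: "x \<in> {..n} \<times> {..m}" "?t n m x \<noteq> 0" by blast
    obtain j i where "x = (j, i)" by (cases x)
    then have "monomial_weight i0 j0 + monomial_weight i1 j1 \<le> monomial_weight m n"
      using *[of n m j i] x by simp
    then show ?thesis by (simp add: algebra_simps)
  qed
  then have "poly_weight (P * Q) = monomial_weight (i0 + i1) (j0 + j1)" by (rule poly_weight_eqI[OF nz])
  then show ?thesis using P Q by (simp add: algebra_simps)
qed

lemma poly_weight_add:
  assumes "P + Q \<noteq> 0"
  shows "min (poly_weight P) (poly_weight Q) \<le> poly_weight (P + Q)"
proof -
  obtain i j where ij: "coeff (coeff (P + Q) j) i \<noteq> 0" "poly_weight (P + Q) = monomial_weight i j"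
    using poly_weight_attained[OF assms] by blast
  then have "coeff (coeff P j) i \<noteq> 0 \<or> coeff (coeff Q j) i \<noteq> 0" by auto
  then show ?thesis using poly_weight_le ij by (metis min.coboundedI1 min.coboundedI2)
qed

lemma fract_weight_Fract:
  assumes "P \<noteq> 0" "Q \<noteq> 0"
  shows "fract_weight (Fract P Q) = poly_weight P - poly_weight Q"
  unfolding fract_weight_def
proof (rule the_equality)
  fix r assume "\<exists>P' Q'. P' \<noteq> 0 \<and> Q' \<noteq> 0 \<and> Fract P Q = Fract P' Q' \<and> r = poly_weight P' - poly_weight Q'"
  then obtain P' Q' where *: "P' \<noteq> 0" "Q' \<noteq> 0" "P * Q' = P' * Q" "r = poly_weight P' - poly_weight Q'"
    using assms by (auto simp: eq_fract)
  then have "poly_weight P + poly_weight Q' = poly_weight P' + poly_weight Q"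
    using assms by (metis poly_weight_mult)
  then show "r = poly_weight P - poly_weight Q" using * by simp
qed (use assms in blast)

lemma Fract_nonzero_cases:
  fixes x :: "'k::field rat2"
  assumes "x \<noteq> 0"
  obtains P Q where "x = Fract P Q" "P \<noteq> 0" "Q \<noteq> 0"
  using assms by (cases x rule: Fract_cases_nonzero) auto

lemma fract_weight_mult:
  assumes "x \<noteq> 0" "y \<noteq> 0"
  shows "fract_weight (x * y) = fract_weight x + fract_weight y"
proof -
  obtain P Q where x: "x = Fract P Q" "P \<noteq> 0" "Q \<noteq> 0" using assms(1) by (rule Fract_nonzero_cases)
  obtain P' Q' where y: "y = Fract P' Q'" "P' \<noteq> 0" "Q' \<noteq> 0" using assms(2) by (rule Fract_nonzero_cases)
  show ?thesis using x y by (simp add: fract_weight_Fract poly_weight_mult)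
qed

lemma fract_weight_add:
  assumes "x \<noteq> 0" "y \<noteq> 0" "x + y \<noteq> 0"
  shows "min (fract_weight x) (fract_weight y) \<le> fract_weight (x + y)"
proof -
  obtain P Q where x: "x = Fract P Q" "P \<noteq> 0" "Q \<noteq> 0" using assms(1) by (rule Fract_nonzero_cases)
  obtain P' Q' where y: "y = Fract P' Q'" "P' \<noteq> 0" "Q' \<noteq> 0" using assms(2) by (rule Fract_nonzero_cases)
  have s: "x + y = Fract (P * Q' + P' * Q) (Q * Q')" using x y by (simp add: add_fract)
  have nz: "P * Q' + P' * Q \<noteq> 0" using assms(3) unfolding s by (auto simp: fract_collapse)
  have "min (poly_weight (P * Q')) (poly_weight (P' * Q)) \<le> poly_weight (P * Q' + P' * Q)"
    using nz by (rule poly_weight_add)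
  then show ?thesis using nz x y
    unfolding s by (simp add: fract_weight_Fract poly_weight_mult)
qed

lemma fract_weight_var_s: "fract_weight var_s = 1"
proof -
  have "coeff (coeff [:[:0, 1:]:] j) i \<noteq> (0::'a::field) \<longleftrightarrow> j = 0 \<and> i = 1" for i j
    by (auto simp: coeff_pCons split: nat.splits)
  then have "poly_weight [:[:0::'a, 1:]:] = monomial_weight 1 0" by (intro poly_weight_eqI) simp_all
  moreover have "coeff (coeff 1 j) i \<noteq> (0::'a) \<longleftrightarrow> j = 0 \<and> i = 0" for i j
    by (auto simp: coeff_1)
  then have "poly_weight (1 :: 'a poly poly) = monomial_weight 0 0" by (intro poly_weight_eqI) simp_all
  ultimately show ?thesis unfolding var_s_def by (simp add: fract_weight_Fract)
qed

lemma fract_weight_var_t: "fract_weight var_t = sqrt 2"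
proof -
  have "coeff (coeff [:0, 1:] j) i \<noteq> (0::'a::field) \<longleftrightarrow> j = 1 \<and> i = 0" for i j
    by (auto simp: coeff_pCons split: nat.splits)
  then have "poly_weight [:0::'a poly, 1:] = monomial_weight 0 1" by (intro poly_weight_eqI) simp_all
  moreover have "coeff (coeff 1 j) i \<noteq> (0::'a) \<longleftrightarrow> j = 0 \<and> i = 0" for i j
    by (auto simp: coeff_1)
  then have "poly_weight (1 :: 'a poly poly) = monomial_weight 0 0" by (intro poly_weight_eqI) simp_all
  ultimately show ?thesis unfolding var_t_def by (simp add: fract_weight_Fract)
qed

lemma var_s_nonzero: "var_s \<noteq> (0 :: 'k::field rat2)" and var_t_nonzero: "var_t \<noteq> (0 :: 'k rat2)"
  by (auto simp: var_s_def var_t_def Zero_fract_def eq_fract)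

section \<open>Field homomorphisms and transport of the valuation\<close>

lemma is_field_hom_simps:
  assumes "is_field_hom \<phi>"
  shows "\<phi> 0 = 0" "\<phi> 1 = 1" "\<phi> (x + y) = \<phi> x + \<phi> y" "\<phi> (x * y) = \<phi> x * \<phi> y"
    "\<phi> (- x) = - \<phi> x" "\<phi> (inverse x) = inverse (\<phi> x)"
proof -
  have h: "\<phi> (x + y) = \<phi> x + \<phi> y" "\<phi> (x * y) = \<phi> x * \<phi> y" "\<phi> 1 = 1" for x y
    using assms by (auto simp: is_field_hom_def)
  have h0: "\<phi> 0 = 0" using h(1)[of 0 0] by (metis add_0 add_right_imp_eq)
  show "\<phi> 0 = 0" "\<phi> 1 = 1" "\<phi> (x + y) = \<phi> x + \<phi> y" "\<phi> (x * y) = \<phi> x * \<phi> y" by (fact h0 h)+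
  have "\<phi> x + \<phi> (- x) = 0" using h(1)[of x "- x"] h0 by simp
  then show "\<phi> (- x) = - \<phi> x" by (metis minus_unique)
  show "\<phi> (inverse x) = inverse (\<phi> x)"
  proof (cases "x = 0")
    case False
    then have "\<phi> x * \<phi> (inverse x) = 1" using h(2)[of x "inverse x"] h(3) by simp
    then show ?thesis by (metis inverse_unique)
  qed (use h0 in auto)
qed

lemma is_field_hom_eq_0_iff:
  assumes "is_field_hom \<phi>"
  shows "\<phi> x = 0 \<longleftrightarrow> x = 0"
proof
  assume "\<phi> x = 0"
  show "x = 0"
  proof (rule ccontr)
    assume "x \<noteq> 0"
    then have "\<phi> (x * inverse x) = 1" using is_field_hom_simps(2)[OF assms] by simp
    then show False using \<open>\<phi> x = 0\<close> by (simp add: is_field_hom_simps(4)[OF assms])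
  qed
qed (use is_field_hom_simps(1)[OF assms] in auto)

lemma is_field_hom_inj:
  assumes "is_field_hom \<phi>"
  shows "inj \<phi>"
proof
  fix x y assume "\<phi> x = \<phi> y"
  then have "\<phi> (x + - y) = 0" by (simp only: is_field_hom_simps[OF assms]) simp
  then show "x = y" by (simp add: is_field_hom_eq_0_iff[OF assms])
qed

lemma is_subfield_range:
  assumes "is_field_hom \<phi>"
  shows "is_subfield (range \<phi>)"
proof -
  note h = is_field_hom_simps[OF assms]
  have "0 \<in> range \<phi>" "1 \<in> range \<phi>" using h(1,2) by (metis rangeI)+
  moreover have "\<phi> x + \<phi> y \<in> range \<phi>" "\<phi> x * \<phi> y \<in> range \<phi>" "- \<phi> x \<in> range \<phi>" "inverse (\<phi> x) \<in> range \<phi>" for x y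
    unfolding h(3-6)[symmetric] by (rule rangeI)+
  ultimately show ?thesis unfolding is_subfield_def by blast
qed

text \<open>The towers live inside the splitting field, so the valuation is carried there along the
  injection \<phi>.\<close>

lemma valuation_on_range:
  fixes \<phi> :: "'k::field rat2 \<Rightarrow> 'l::field"
  assumes "is_field_hom \<phi>"
  shows "valuation_on (range \<phi>) (\<lambda>y. fract_weight (inv_into UNIV \<phi> y)) 1 (sqrt 2)"
proof -
  have inv: "inv_into UNIV \<phi> (\<phi> x) = x" for x using is_field_hom_inj[OF assms] by simp
  have grp: "\<exists>p q :: int. fract_weight x = of_int p * 1 + of_int q * sqrt 2" if nz: "x \<noteq> 0" for x :: "'k rat2"
  proof -
    obtain P Q where x: "x = Fract P Q" "P \<noteq> 0" "Q \<noteq> 0" using nz by (rule Fract_nonzero_cases)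
    obtain i j where P: "poly_weight P = monomial_weight i j" using x(2) by (rule poly_weight_attained)
    obtain i' j' where Q: "poly_weight Q = monomial_weight i' j'" using x(3) by (rule poly_weight_attained)
    have "fract_weight x = of_int (int i - int i') * 1 + of_int (int j - int j') * sqrt 2"
      using x P Q by (simp add: fract_weight_Fract algebra_simps)
    then show ?thesis by blast
  qed
  have "is_subfield (range \<phi>)" by (rule is_subfield_range[OF assms])
  \<comment> \<open>Quantifiers over \<open>range \<phi>\<close> become quantifiers over k(s,t), and
    \<phi> is pulled out of sums and products so that \<open>inv\<close> cancels it.\<close>
  then show ?thesis
    unfolding valuation_on_def ball_simps is_field_hom_simps(3,4)[OF assms, symmetric] inv
      is_field_hom_eq_0_iff[OF assms]
    using grp fract_weight_mult fract_weight_add by blast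
qed

section \<open>The action of \<open>F\<^sub>2[Y]\<close>\<close>

context char2_field
begin

definition ell :: "'a \<Rightarrow> 'a" where
  "ell x = x * x + s * x"

text \<open>Horner evaluation of p(L)(x), with L = \<open>ell\<close>; a coefficient in F_2 only
  decides whether \<open>x\<close> is added.\<close>

definition act :: "bit poly \<Rightarrow> 'a \<Rightarrow> 'a" where
  "act p x = fold_coeffs (\<lambda>c y. (if c = 0 then 0 else x) + ell y) p 0"

lemma ell_0 [simp]: "ell 0 = 0" and ell_s [simp]: "ell s = 0"
  by (simp_all add: ell_def)

lemma ell_add: "ell (x + y) = ell x + ell y"
proof -
  have "ell (x + y) = ell x + ell y + (x * y + x * y)" unfolding ell_def by (simp only: algebra_simps)
  then show ?thesis by simp
qed

lemma ell_eq_0: "ell x = 0 \<Longrightarrow> x = 0 \<or> x = s"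
proof -
  assume "ell x = 0"
  then have "x * (x + s) = 0" by (simp add: ell_def algebra_simps)
  then show ?thesis by (auto simp: add_eq_0_iff)
qed

lemma funpow_ell_0 [simp]: "(ell ^^ i) 0 = 0"
  by (induction i) auto

lemma act_0 [simp]: "act 0 x = 0"
  by (simp add: act_def)

lemma act_pCons: "act (pCons c p) x = (if c = 0 then 0 else x) + ell (act p x)"
  by (cases "p = 0 \<and> c = 0") (auto simp: act_def)

lemma act_1 [simp]: "act 1 x = x"
  unfolding one_pCons act_pCons by simp

lemma act_zero_right [simp]: "act p 0 = 0"
  by (induction p) (auto simp: act_pCons)

lemma act_ell: "act p (ell x) = ell (act p x)"
  by (induction p) (auto simp: act_pCons ell_add)

lemma act_funpow_ell: "act p ((ell ^^ i) x) = (ell ^^ i) (act p x)"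
  by (induction i) (auto simp: act_ell)

lemma act_smult: "act (smult c p) x = (if c = 0 then 0 else act p x)"
  by (cases "c = 0") auto

lemma act_add: "act (p + q) x = act p x + act q x"
proof (induction p q rule: poly_induct2)
  case (pCons a p b q)
  then show ?case
    by (cases a; cases b) (auto simp: act_pCons ell_add algebra_simps)
qed auto

lemma act_mult: "act (p * q) x = act p (act q x)"
  by (induction p) (auto simp: act_add act_smult act_pCons)

lemma act_monom: "act (monom 1 i) x = (ell ^^ i) x"
  by (induction i) (auto simp: monom_0 monom_Suc act_pCons)

lemma act_s: "act p s = (if coeff p 0 = 0 then 0 else s)"
proof -
  obtain c q where p: "p = pCons c q" by (cases p)
  have "ell (act q s) = 0" using act_ell[of q s] by simp
  then show ?thesis by (simp add: p act_pCons)
qed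

text \<open>Freeness of the module. The power of L taking \<open>x\<close> to \<open>s\<close> shows
  that \<open>p\<close> kills \<open>s\<close>, so p = Y q; then \<open>q\<close> kills L(x), one
  level lower.\<close>

lemma act_inj_0:
  assumes "(ell ^^ m) x = s" "degree p < Suc m" "act p x = 0"
  shows "p = 0"
  using assms
proof (induction m arbitrary: p x)
  case 0
  then obtain c where "p = [:c:]" by (auto elim: degree_eq_zeroE)
  then show ?case using 0 act_s[of p] s_nonzero by (auto split: if_splits)
next
  case (Suc m)
  obtain c q where p: "p = pCons c q" by (cases p)
  have "act p s = 0" using act_funpow_ell[of p "Suc m" x] Suc.prems by simp
  then have c: "c = 0" using act_s[of p] s_nonzero by (auto simp: p split: if_splits)
  then have "act q (ell x) = 0" using Suc.prems by (simp add: p act_pCons act_ell)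
  moreover have "(ell ^^ m) (ell x) = s" using Suc.prems(1) by (simp add: funpow_swap1)
  moreover have "degree q < Suc m" using Suc.prems(2) by (auto simp: p split: if_splits)
  ultimately have "q = 0" by (intro Suc.IH)
  then show ?case using c p by simp
qed

text \<open>Cyclicity of the kernel. By induction L(y) = q L(x), so \<open>y\<close> and q x differ
  by 0 or \<open>s\<close>; since \<open>s\<close> is a power of Y applied to \<open>x\<close>, it
  can be absorbed into \<open>q\<close>.\<close>

lemma act_surj:
  assumes "(ell ^^ m) x = s" "(ell ^^ Suc m) y = 0"
  shows "\<exists>p. degree p < Suc m \<and> act p x = y"
  using assms
proof (induction m arbitrary: x y)
  case 0
  then have "y = 0 \<or> y = s" using ell_eq_0 by simp
  then show ?case
  proof
    assume "y = 0" then show ?thesis by (intro exI[of _ 0]) simp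
  next
    assume "y = s" then show ?thesis using 0 by (intro exI[of _ 1]) simp
  qed
next
  case (Suc m)
  have "(ell ^^ m) (ell x) = s" "(ell ^^ Suc m) (ell y) = 0" using Suc.prems by (simp_all add: funpow_swap1)
  then obtain q where q: "degree q < Suc m" "act q (ell x) = ell y" using Suc.IH by blast
  have "ell (y + act q x) = 0" using q by (simp add: ell_add flip: act_ell)
  then consider "y + act q x = 0" | "y + act q x = s" using ell_eq_0 by blast
  then show ?case
  proof cases
    case 1
    then have "act q x = y" by (auto simp: add_eq_0_iff)
    then show ?thesis using q by (intro exI[of _ q]) simp
  next
    case 2
    have "act (q + monom 1 (Suc m)) x = act q x + s"
      using Suc.prems(1) by (simp only: act_add act_monom)
    also have "\<dots> = act q x + (y + act q x)" by (simp only: 2)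
    also have "\<dots> = y" by (simp add: add.left_commute[of _ y])
    finally have "act (q + monom 1 (Suc m)) x = y" .
    moreover have "degree (q + monom 1 (Suc m)) < Suc (Suc m)"
      using q degree_add_le[of q "Suc m" "monom 1 (Suc m)"] degree_monom_le[of "1 :: bit" "Suc m"] by simp
    ultimately show ?thesis by blast
  qed
qed

text \<open>Truncation changes \<open>p\<close> by a multiple of Y^n, which kills
  \<open>x\<close>.\<close>

lemma act_truncR:
  assumes "(ell ^^ n) x = 0"
  shows "act (truncR n p) x = act p x"
proof -
  have "monom 1 n dvd p - truncR n p"
    unfolding monom_1_dvd_iff' by (auto simp: truncR_def coeff_sum)
  then obtain r where "p - truncR n p = monom 1 n * r" by (elim dvdE)
  then have "p = truncR n p + monom 1 n * r" by (simp add: algebra_simps)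
  then have "act p x = act (truncR n p) x + (ell ^^ n) (act r x)"
    by (metis act_add act_mult act_monom)
  then show ?thesis using act_funpow_ell[of r n x] assms by simp
qed

lemma act_mem:
  assumes "is_subfield E" "s \<in> E" "x \<in> E"
  shows "act p x \<in> E"
  using is_subfield_closed[OF assms(1)] assms(2,3)
  by (induction p) (auto simp: act_pCons ell_def)

lemma field_hom_ell:
  assumes "is_field_hom \<sigma>" "\<sigma> s = s"
  shows "\<sigma> ((ell ^^ i) x) = (ell ^^ i) (\<sigma> x)"
  using assms(2) by (induction i) (simp_all add: ell_def is_field_hom_simps[OF assms(1)])

lemma field_hom_act:
  assumes "is_field_hom \<sigma>" "\<sigma> s = s"
  shows "\<sigma> (act p x) = act p (\<sigma> x)"
  using field_hom_ell[OF assms, of 1]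
  by (induction p) (simp_all add: act_pCons is_field_hom_simps[OF assms(1)])

end

section \<open>Truncated polynomials, coefficient maps and split polynomials\<close>

lemma Rn_truncR: "1 \<le> n \<Longrightarrow> truncR n p \<in> Rn n"
  unfolding Rn_def truncR_def
  by (auto intro!: degree_sum_less simp: degree_monom_eq le_less_trans[OF degree_monom_le])

lemma Rn_add: "p \<in> Rn n \<Longrightarrow> q \<in> Rn n \<Longrightarrow> p + q \<in> Rn n"
  unfolding Rn_def using degree_add_less by blast

lemma coeff_unitsR:
  assumes "1 \<le> n" "u \<in> unitsR n"
  shows "coeff u 0 \<noteq> 0"
proof
  assume u0: "coeff u 0 = 0"
  obtain v where "truncR n (u * v) = 1" using assms(2) by (auto simp: unitsR_def mulR_def)
  then have "coeff (truncR n (u * v)) 0 = 1" by simp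
  moreover have "coeff (truncR n (u * v)) 0 = coeff (u * v) 0"
    using assms(1) by (auto simp: truncR_def coeff_sum)
  ultimately show False using u0 by (simp add: coeff_mult_0)
qed

lemma map_poly_hom_add:
  assumes "is_field_hom \<phi>"
  shows "map_poly \<phi> (p + q) = map_poly \<phi> p + map_poly \<phi> q"
  by (rule poly_eqI) (simp add: coeff_map_poly is_field_hom_simps[OF assms])

lemma is_field_hom_sum:
  assumes "is_field_hom \<phi>"
  shows "\<phi> (sum f A) = (\<Sum>x\<in>A. \<phi> (f x))"
  by (induction A rule: infinite_finite_induct) (simp_all add: is_field_hom_simps[OF assms])

lemma map_poly_hom_mult:
  assumes "is_field_hom \<phi>"
  shows "map_poly \<phi> (p * q) = map_poly \<phi> p * map_poly \<phi> q"
  by (rule poly_eqI)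
    (simp add: coeff_map_poly coeff_mult is_field_hom_sum[OF assms] is_field_hom_simps[OF assms])

text \<open>Linear factors are stripped one at a time: if \<open>a\<close> is not a root of
  \<open>p\<close>, then X - a divides the cofactor and cancels.\<close>

lemma root_of_dvd_split:
  fixes p :: "'a::field poly"
  assumes "p dvd prod_list (map (\<lambda>a. [:- a, 1:]) rs)" "0 < degree p"
  shows "\<exists>a. poly p a = 0"
  using assms(1)
proof (induction rs)
  case Nil
  then have "degree p = 0" using is_unit_iff_degree[of p] by force
  then show ?case using assms(2) by simp
next
  case (Cons a rs)
  show ?case
  proof (cases "poly p a = 0")
    case False
    obtain q where q: "[:- a, 1:] * prod_list (map (\<lambda>a. [:- a, 1:]) rs) = p * q"
      using Cons.prems by (auto elim: dvdE)
    then have "poly (p * q) a = 0" by (metis poly_mult poly_eq_0_iff_dvd dvd_triv_left)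
    then have "[:- a, 1:] dvd q" using False by (simp add: poly_eq_0_iff_dvd)
    then obtain q' where "q = [:- a, 1:] * q'" by (elim dvdE)
    then have "[:- a, 1:] * prod_list (map (\<lambda>a. [:- a, 1:]) rs) = [:- a, 1:] * (p * q')"
      using q by (simp only: mult.left_commute)
    then have "prod_list (map (\<lambda>a. [:- a, 1:]) rs) = p * q'"
      by (subst (asm) mult_cancel_left) simp
    then show ?thesis using Cons.IH by simp
  qed auto
qed

lemma two_eq_0_rat2:
  assumes "CHAR('k::field) = 2"
  shows "(2 :: 'k rat2) = 0"
proof -
  have "(of_nat 2 :: 'k) = 0" using of_nat_CHAR[where 'a = 'k] assms by metis
  then have "(of_nat 2 :: 'k poly poly) = 0" by (simp only: of_nat_poly) simp
  then have "(of_nat 2 :: 'k rat2) = 0" by (simp only: of_nat_fract Zero_fract_def)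
  then show ?thesis by simp
qed

section \<open>The roots and the Galois group\<close>

text \<open>The index is shifted, n = m + 1: it takes \<open>m\<close> quadratic steps from
  \<open>s\<close> to the generator.\<close>

locale quadratic_iterate =
  fixes \<phi> :: "'k::field rat2 \<Rightarrow> 'l::field" and m :: nat
  assumes char: "CHAR('k) = 2" and splitting: "is_splitting_field \<phi> (Giter (Suc m))"
begin

lemma hom: "is_field_hom \<phi>"
  using splitting by (simp add: is_splitting_field_def)

abbreviation s where "s \<equiv> \<phi> var_s"
abbreviation t where "t \<equiv> \<phi> var_t"

sublocale char2_field s
proof
  have "\<phi> (1 + 1) = 0" using two_eq_0_rat2[OF char] is_field_hom_simps(1)[OF hom] by simp
  then have "1 + 1 = (0::'l)" by (simp only: is_field_hom_simps[OF hom])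
  then show "(2::'l) = 0" by simp
  show "s \<noteq> 0" using is_field_hom_eq_0_iff[OF hom] var_s_nonzero by blast
qed

definition g :: "'l \<Rightarrow> 'l" where
  "g x = ell x + t"

definition iter_poly :: "nat \<Rightarrow> 'l poly" where
  "iter_poly i = map_poly \<phi> (Giter i)"

definition roots :: "'l set" where
  "roots = {a. (g ^^ Suc m) a = 0}"

lemma iter_poly_0: "iter_poly 0 = [:0, 1:]"
  by (simp add: iter_poly_def Giter_def map_poly_pCons is_field_hom_simps[OF hom])

lemma iter_poly_Suc: "iter_poly (Suc i) = iter_poly i * iter_poly i + [:s:] * iter_poly i + [:t:]"
proof -
  have G: "Giter (Suc i) = Giter i * Giter i + [:var_s:] * Giter i + ([:var_t:] :: 'k rat2 poly)"
    by (simp add: Giter_def Gpoly_def pcompose_pCons algebra_simps)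
  show ?thesis
    unfolding iter_poly_def
    by (simp only: G map_poly_hom_add[OF hom] map_poly_hom_mult[OF hom])
      (simp add: map_poly_pCons is_field_hom_simps[OF hom])
qed

lemma poly_iter_poly: "poly (iter_poly i) x = (g ^^ i) x"
  by (induction i) (simp_all add: iter_poly_0 iter_poly_Suc g_def ell_def)

lemma degree_iter_poly: "degree (iter_poly i) = 2 ^ i"
proof -
  have "degree (iter_poly i) = degree (Giter i :: 'k rat2 poly)"
    unfolding iter_poly_def using is_field_hom_eq_0_iff[OF hom] by (intro degree_map_poly) auto
  also have "\<dots> = 2 ^ i"
    by (induction i) (simp_all add: Giter_def Gpoly_def degree_pcompose)
  finally show ?thesis .
qed

lemma roots_eq: "roots = {a. poly (map_poly \<phi> (Giter (Suc m))) a = 0}"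
  unfolding roots_def using poly_iter_poly[of "Suc m"] by (simp add: iter_poly_def)

lemma finite_roots: "finite roots"
proof -
  have "iter_poly (Suc m) \<noteq> 0" using degree_iter_poly[of "Suc m"] by auto
  then show ?thesis unfolding roots_eq using poly_roots_finite by (simp add: iter_poly_def)
qed

lemma subfield_eq_UNIV: "is_subfield S \<Longrightarrow> range \<phi> \<subseteq> S \<Longrightarrow> roots \<subseteq> S \<Longrightarrow> S = UNIV"
  using splitting unfolding is_splitting_field_def roots_eq by blast

lemma root_of_dvd_iter_poly:
  assumes "p dvd iter_poly (Suc m)" "0 < degree p"
  shows "\<exists>a. poly p a = 0"
proof -
  obtain c rs where rs: "iter_poly (Suc m) = smult c (prod_list (map (\<lambda>a. [:- a, 1:]) rs))"
    using splitting unfolding is_splitting_field_def iter_poly_def by blast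
  have "c \<noteq> 0" using degree_iter_poly[of "Suc m"] rs by auto
  then have "p dvd prod_list (map (\<lambda>a. [:- a, 1:]) rs)" using assms(1) rs by (simp add: dvd_smult_iff)
  then show ?thesis using root_of_dvd_split assms(2) by blast
qed

text \<open>The constant \<open>t\<close> cancels in the sum; hence the roots form a coset of the
  kernel of a power of L.\<close>

lemma funpow_g_add: "(g ^^ i) x + (g ^^ i) y = (ell ^^ i) (x + y)"
proof (induction i)
  case (Suc i)
  have "(g ^^ Suc i) x + (g ^^ Suc i) y = ell ((g ^^ i) x + (g ^^ i) y) + (t + t)"
    by (simp only: g_def ell_add funpow.simps o_apply add_ac)
  then show ?case using Suc by simp
qed simp

text \<open>With c = G^m(b), the roots of G are c and c + s, so G^(m+1) = (G^m + c)(G^m + c + s). A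
  root b' of the second factor yields v = b + b'.\<close>

lemma ex_base_root_and_generator: "\<exists>b v. (g ^^ Suc m) b = 0 \<and> (ell ^^ m) v = s"
proof -
  obtain b where b: "(g ^^ Suc m) b = 0"
    using root_of_dvd_iter_poly[of "iter_poly (Suc m)"] degree_iter_poly[of "Suc m"]
    unfolding poly_iter_poly by auto
  define c where "c = (g ^^ m) b"
  define P where "P = iter_poly m"
  have "c * c + s * c + t = 0" using b by (simp add: c_def g_def ell_def)
  then have t: "t = c * (c + s)" by (simp add: add_eq_0_iff algebra_simps)
  have z: "[:c:] * P + [:c:] * P = 0"
    by (rule poly_eqI) (simp only: coeff_add add_self coeff_0)
  have "(P + [:c + s:]) * (P + [:c:]) = P * P + [:s:] * P + [:t:] + ([:c:] * P + [:c:] * P)"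
  proof -
    have "[:c + s:] = [:c:] + [:s:]" "[:t:] = [:c:] * ([:c:] + [:s:])" unfolding t by simp_all
    then show ?thesis by (simp only: algebra_simps)
  qed
  then have "iter_poly (Suc m) = (P + [:c + s:]) * (P + [:c:])"
    unfolding z by (simp only: iter_poly_Suc P_def add_0_right)
  then have "P + [:c + s:] dvd iter_poly (Suc m)" by simp
  moreover have "0 < degree (P + [:c + s:])"
    using degree_iter_poly[of m] by (subst degree_add_eq_left) (auto simp: P_def)
  ultimately obtain b' where "poly (P + [:c + s:]) b' = 0" using root_of_dvd_iter_poly by blast
  then have "(g ^^ m) b' = c + s" by (simp add: P_def poly_iter_poly add_eq_0_iff2)
  then have "(ell ^^ m) (b + b') = s" using funpow_g_add[of m b b'] by (simp add: c_def)
  then show ?thesis using b by blast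
qed

end

section \<open>The torsor of roots and its coordinates in R_n\<close>

locale quadratic_iterate_base = quadratic_iterate +
  fixes b v :: "'b"
  assumes g_b: "(g ^^ Suc m) b = 0" and ell_v: "(ell ^^ m) v = s"
begin

abbreviation n where "n \<equiv> Suc m"

definition param :: "bit poly \<Rightarrow> 'b" where
  "param p = b + act p v"

lemma ell_n_v: "(ell ^^ n) v = 0"
  using ell_v by simp

lemma mem_roots_iff: "a \<in> roots \<longleftrightarrow> (ell ^^ n) (b + a) = 0"
  using funpow_g_add[of n b a] g_b by (simp add: roots_def)

lemma ell_n_act: "(ell ^^ n) (act p v) = 0"
  using act_funpow_ell[of p n v] ell_n_v by simp

lemma ker_ell_n: "(ell ^^ n) y = 0 \<Longrightarrow> \<exists>p\<in>Rn n. y = act p v"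
  using act_surj[OF ell_v, of y] by (auto simp: Rn_def)

lemma act_v_inj:
  assumes "p \<in> Rn n" "q \<in> Rn n" "act p v = act q v"
  shows "p = q"
proof -
  have "act (p + q) v = 0" using assms(3) by (simp add: act_add)
  then have "p + q = 0" using act_inj_0[OF ell_v] Rn_add[OF assms(1,2)] by (auto simp: Rn_def)
  moreover have "x + x = 0" for x :: bit by (cases x) simp_all
  then have "q + q = 0" by (intro poly_eqI) (simp only: coeff_add coeff_0)
  ultimately show ?thesis by (metis add_right_imp_eq)
qed

lemma param_bij: "bij_betw param (Rn n) roots"
  unfolding bij_betw_def
proof
  show "inj_on param (Rn n)" unfolding inj_on_def param_def using act_v_inj by auto
  show "param ` Rn n = roots"
  proof
    show "param ` Rn n \<subseteq> roots" unfolding param_def mem_roots_iff image_subset_iff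
      using ell_n_act by simp
    show "roots \<subseteq> param ` Rn n"
    proof
      fix a assume "a \<in> roots"
      then obtain p where "p \<in> Rn n" "b + a = act p v" using mem_roots_iff ker_ell_n by blast
      then show "a \<in> param ` Rn n" by (intro image_eqI[of _ _ p]) (auto simp: param_def simp flip: \<open>b + a = act p v\<close>)
    qed
  qed
qed

lemma roots_subset:
  assumes "is_subfield E" "s \<in> E" "b \<in> E" "v \<in> E"
  shows "roots \<subseteq> E"
proof
  fix a assume "a \<in> roots"
  then obtain p where "a = param p" using param_bij unfolding bij_betw_def by blast
  then show "a \<in> E"
    unfolding param_def using assms act_mem is_subfield_closed(3) by blast
qed

text \<open>The identity of k(s,t) is prolonged along two towers, first to \<open>v\<close> and then
  to \<open>b\<close>; the images may be any elements obeying the same recursion under L.\<close>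

lemma ex_hom:
  assumes u: "coeff u 0 \<noteq> 0"
  shows "\<exists>\<sigma>. is_field_hom \<sigma> \<and> (\<forall>a. \<sigma> (\<phi> a) = \<phi> a) \<and> \<sigma> v = act u v \<and> \<sigma> b = b + act w v"
proof -
  let ?K = "range \<phi>"
  let ?w = "\<lambda>y. fract_weight (inv_into UNIV \<phi> y)"
  have ws: "?w s = 1" and wt: "?w t = sqrt 2"
    using is_field_hom_inj[OF hom] fract_weight_var_s fract_weight_var_t by simp_all
  have t_nz: "t \<noteq> 0" using is_field_hom_eq_0_iff[OF hom] var_t_nonzero by blast
  have sqrt2: "sqrt 2 < 2" using real_less_lsqrt[of 2 2] by (simp add: real_sqrt_less_iff)
  note K0 = is_subfield_closed(1)[OF is_subfield_range[OF hom]]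
  \<comment> \<open>Indexed from the bottom: the chain climbs from \<open>x 0 = s\<close> to
    \<open>x m = v\<close>.\<close>
  define x where "x i = (ell ^^ (m - i)) v" for i
  have xS: "ell (x (Suc i)) = x i" if "i < m" for i
  proof -
    have "m - i = Suc (m - Suc i)" using that by simp
    then show ?thesis by (simp add: x_def)
  qed
  have x0: "x 0 = s" and xm: "x m = v" using ell_v by (simp_all add: x_def)
  \<comment> \<open>First tower: the value 1 of \<open>s\<close> is halved \<open>m\<close> times,
    while sqrt 2 stays as the other generator.\<close>
  obtain E1 w1 where val1: "valuation_on E1 w1 (1 / 2 ^ m) (sqrt 2)" and ind1: "int_independent (1 / 2 ^ m) (sqrt 2)"
    and sub1: "?K \<subseteq> E1" and ext1: "\<And>y. y \<in> ?K \<Longrightarrow> y \<noteq> 0 \<Longrightarrow> w1 y = ?w y"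
    and mem1: "\<And>i. i \<le> m \<Longrightarrow> x i \<in> E1"
    and hom1: "homs_extend ?K E1 x 0 m"
  proof -
    have rec: "(x (Suc i) + 0) * (x (Suc i) + 0) + s * (x (Suc i) + 0) = x i" if "i < m" for i
      using xS[OF that] by (simp add: ell_def)
    have init: "s \<in> ?K" "1 < 2 * ?w s" "(0::real) < 1" "x 0 \<in> ?K" "x 0 \<noteq> 0" "?w (x 0) = 1"
      "0 \<in> ?K" "(0::'b) = 0 \<or> 1 \<le> ?w 0"
      unfolding x0 ws using s_nonzero K0 by simp_all
    show ?thesis
      using quadratic_tower[where x = x and d = 0 and k = m, OF valuation_on_range[OF hom] int_independent_1_sqrt_2 init rec] that by blast
  qed
  have st1: "s \<in> E1" "t \<in> E1" using sub1 by auto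
  have w1: "w1 s = 1" "w1 t = sqrt 2" using ext1 ws wt s_nonzero t_nz by auto
  \<comment> \<open>With b_i = G^(n-i)(b), this is b_i + t = L(b_(i+1)). The tower starts at
    \<open>y 0 = t\<close>, and the shift by \<open>t\<close> recovers b_i.\<close>
  define y where "y i = t + (g ^^ (n - i)) b" for i
  have yt: "y i + t = (g ^^ (n - i)) b" for i unfolding y_def by (simp add: add.commute[of t] add.assoc)
  have yS: "ell (y (Suc i) + t) = y i" if "i < n" for i
  proof -
    have "n - i = Suc (n - Suc i)" using that by simp
    then show ?thesis unfolding yt unfolding y_def by (simp add: g_def add.commute)
  qed
  have y0: "y 0 = t" using g_b by (simp add: y_def)
  \<comment> \<open>Second tower, with the generators exchanged: sqrt 2 is halved, and it is below
    twice the value 1 of \<open>s\<close>.\<close>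
  obtain E2 w2 where val2: "valuation_on E2 w2 (sqrt 2 / 2 ^ n) (1 / 2 ^ m)"
    and sub2: "E1 \<subseteq> E2" and mem2: "\<And>i. i \<le> n \<Longrightarrow> y i \<in> E2"
    and hom2: "homs_extend E1 E2 y t n"
  proof -
    have rec: "(y (Suc i) + t) * (y (Suc i) + t) + s * (y (Suc i) + t) = y i" if "i < n" for i
      using yS[OF that] unfolding ell_def .
    have init: "s \<in> E1" "sqrt 2 < 2 * w1 s" "0 < sqrt 2" "y 0 \<in> E1" "y 0 \<noteq> 0" "w1 (y 0) = sqrt 2"
      "t \<in> E1" "t = 0 \<or> sqrt 2 \<le> w1 t"
      unfolding y0 w1 using st1 t_nz sqrt2 by simp_all
    show ?thesis
      using quadratic_tower[where x = y and d = t and k = n, OF valuation_on_swap[OF val1] int_independent_swap[OF ind1] init rec] that by blast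
  qed
  have vE: "v \<in> E1" using mem1[of m] xm by simp
  note sf2 = valuation_on_subfield[OF val2]
  have b_eq: "y n + t = b" using yt[of n] by simp
  have "b \<in> E2" using is_subfield_closed(3)[OF sf2, of "y n" t] mem2[of n] st1 sub2 b_eq by auto
  then have "roots \<subseteq> E2" using roots_subset[OF sf2] vE st1 sub2 by blast
  \<comment> \<open>The top of the towers is the whole splitting field, so homomorphisms on it are
    endomorphisms.\<close>
  then have E2: "E2 = UNIV" using subfield_eq_UNIV[OF sf2] sub1 sub2 by blast

  have "field_hom_on ?K (\<lambda>x. x)" by (simp add: field_hom_on_def)
  \<comment> \<open>The nonzero constant coefficient of \<open>u\<close> enters here: the identity
    can be prolonged only if \<open>u\<close> fixes \<open>s\<close>.\<close>
  moreover have "x 0 = act u (x 0)" using u by (simp add: x0 act_s)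
  moreover have "\<forall>i<m. (act u (x (Suc i)) + 0) * (act u (x (Suc i)) + 0) + s * (act u (x (Suc i)) + 0) = act u (x i)"
    using xS act_ell by (metis add_0_right ell_def)
  ultimately obtain \<tau> where \<tau>: "field_hom_on E1 \<tau>" "\<forall>y\<in>?K. \<tau> y = y" "\<forall>i\<le>m. \<tau> (x i) = act u (x i)"
    using hom1[unfolded homs_extend_def, rule_format, of "\<lambda>x. x" "\<lambda>i. act u (x i)"] by auto
  have \<tau>v: "\<tau> v = act u v" using \<tau>(3) xm by auto
  \<comment> \<open>The translation by w v is pushed down the tower by powers of L; at the bottom it
    vanishes because L^n kills \<open>v\<close>.\<close>
  define y' where "y' i = y i + act w ((ell ^^ (n - i)) v)" for i
  have rec': "(y' (Suc i) + t) * (y' (Suc i) + t) + s * (y' (Suc i) + t) = y' i" if "i < n" for i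
  proof -
    have n: "n - i = Suc (n - Suc i)" using that by simp
    have "ell (y' (Suc i) + t) = ell ((y (Suc i) + t) + act w ((ell ^^ (n - Suc i)) v))"
      unfolding y'_def by (simp only: add_ac)
    also have "\<dots> = y i + act w ((ell ^^ (n - i)) v)"
      unfolding n by (simp only: ell_add[of "y (Suc i) + t"] yS[OF that] funpow.simps o_apply act_ell)
    finally show ?thesis unfolding y'_def ell_def .
  qed
  have "y' 0 = t" using ell_n_v by (simp add: y'_def y0)
  then obtain \<sigma> where \<sigma>: "field_hom_on E2 \<sigma>" "\<forall>y\<in>E1. \<sigma> y = \<tau> y" "\<forall>i\<le>n. \<sigma> (y i) = y' i"
    using hom2[unfolded homs_extend_def, rule_format, OF \<tau>(1), of y'] \<tau>(2) y0 rec' by auto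
  have hom\<sigma>: "is_field_hom \<sigma>" using \<sigma>(1) unfolding E2 field_hom_on_def is_field_hom_def by blast
  have fixed: "\<sigma> (\<phi> a) = \<phi> a" for a
    using \<sigma>(2) \<tau>(2) subsetD[OF sub1 rangeI, of a] by simp
  have "\<sigma> b = \<sigma> (y n) + \<sigma> t" unfolding b_eq[symmetric] by (rule is_field_hom_simps[OF hom\<sigma>])
  also have "\<dots> = (y n + t) + act w v" using \<sigma>(3) fixed by (simp add: y'_def add_ac)
  finally have "\<sigma> b = b + act w v" unfolding b_eq .
  moreover have "\<sigma> v = act u v" using \<sigma>(2) vE \<tau>v by simp
  ultimately show ?thesis using hom\<sigma> fixed by blast
qed

section \<open>The Galois group as the affine group\<close>

lemma galois_groupD:
  assumes "\<sigma> \<in> carrier (galois_group \<phi>)"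
  shows "bij \<sigma>" "is_field_hom \<sigma>" "\<sigma> (\<phi> a) = \<phi> a"
  using assms by (auto simp: galois_group_def)

lemma hom_funpow_g:
  assumes "is_field_hom \<sigma>" "\<And>a. \<sigma> (\<phi> a) = \<phi> a"
  shows "\<sigma> ((g ^^ i) a) = (g ^^ i) (\<sigma> a)"
  using assms(2) by (induction i) (simp_all add: g_def ell_def is_field_hom_simps[OF assms(1)])

lemma hom_maps_roots:
  assumes "is_field_hom \<sigma>" "\<And>a. \<sigma> (\<phi> a) = \<phi> a"
  shows "\<sigma> ` roots = roots"
proof (rule endo_inj_surj[OF finite_roots])
  show "\<sigma> ` roots \<subseteq> roots"
    using hom_funpow_g[OF assms, of "Suc m"] is_field_hom_simps(1)[OF assms(1)]
    unfolding roots_def by (auto simp del: funpow.simps) metis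
  show "inj_on \<sigma> roots" using is_field_hom_inj[OF assms(1)] inj_on_subset by blast
qed

text \<open>Surjectivity: the image is a subfield containing the base field and all roots.\<close>

lemma hom_in_galois_group:
  assumes "is_field_hom \<sigma>" "\<And>a. \<sigma> (\<phi> a) = \<phi> a"
  shows "\<sigma> \<in> carrier (galois_group \<phi>)"
proof -
  have "range \<phi> \<subseteq> range \<sigma>" using assms(2) by (metis image_subsetI rangeI)
  moreover have "roots \<subseteq> range \<sigma>" using hom_maps_roots[OF assms] by blast
  ultimately have "range \<sigma> = UNIV" using subfield_eq_UNIV[OF is_subfield_range[OF assms(1)]] by blast
  then have "bij \<sigma>" using is_field_hom_inj[OF assms(1)] by (simp add: bij_def)
  then show ?thesis using assms by (simp add: galois_group_def)
qed

lemma hom_param: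
  assumes "is_field_hom \<sigma>" "\<And>a. \<sigma> (\<phi> a) = \<phi> a" "\<sigma> v = act u v" "\<sigma> b = b + act w v"
  shows "\<sigma> (param p) = param (mulR n u p + w)"
proof -
  have "\<sigma> (param p) = (b + act w v) + act p (act u v)"
    unfolding param_def by (simp only: is_field_hom_simps[OF assms(1)] field_hom_act[OF assms(1,2)] assms(3,4))
  also have "act p (act u v) = act (mulR n u p) v"
    unfolding mulR_def act_truncR[OF ell_n_v] by (simp only: mult.commute[of u] act_mult)
  finally show ?thesis unfolding param_def act_add by (simp only: add_ac)
qed

lemma galois_affine:
  assumes "\<sigma> \<in> carrier (galois_group \<phi>)"
  shows "\<exists>u\<in>unitsR n. \<exists>w\<in>Rn n. \<forall>p. \<sigma> (param p) = param (mulR n u p + w)"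
proof -
  note \<sigma> = galois_groupD[OF assms]
  have b: "b \<in> roots" using g_b by (simp add: roots_def)
  then have "\<sigma> b \<in> roots" using hom_maps_roots[OF \<sigma>(2,3)] by blast
  then obtain w where w: "w \<in> Rn n" "b + \<sigma> b = act w v" using mem_roots_iff ker_ell_n by blast
  then have \<sigma>b: "\<sigma> b = b + act w v" by (simp flip: w(2))
  have "(ell ^^ n) (\<sigma> v) = 0"
    using field_hom_ell[OF \<sigma>(2,3), of n v] ell_n_v is_field_hom_simps(1)[OF \<sigma>(2)] by metis
  then obtain u where u: "u \<in> Rn n" "\<sigma> v = act u v" using ker_ell_n by blast
  \<comment> \<open>For the inverse of \<open>u\<close>: the preimage of \<open>v\<close> also lies
    in the kernel of L^n, so it is u' v, and applying \<sigma> gives v = u' u v.\<close>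
  obtain z where z: "\<sigma> z = v" using \<sigma>(1) by (metis bij_pointE)
  have "\<sigma> ((ell ^^ n) z) = 0" using field_hom_ell[OF \<sigma>(2,3), of n z] z ell_n_v by simp
  then have "(ell ^^ n) z = 0" using is_field_hom_eq_0_iff[OF \<sigma>(2)] by blast
  then obtain u' where u': "u' \<in> Rn n" "z = act u' v" using ker_ell_n by blast
  have "v = act u' (act u v)" using z u u' field_hom_act[OF \<sigma>(2,3)] by simp
  also have "\<dots> = act (mulR n u u') v"
    unfolding mulR_def act_truncR[OF ell_n_v] by (simp only: mult.commute[of u] act_mult)
  finally have "act (mulR n u u') v = act 1 v" by simp
  moreover have "1 \<in> Rn n" by (simp add: Rn_def)
  ultimately have "mulR n u u' = 1" using act_v_inj Rn_truncR unfolding mulR_def by auto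
  then have "u \<in> unitsR n" using u u' by (auto simp: unitsR_def)
  then show ?thesis using hom_param[OF \<sigma>(2,3) u(2) \<sigma>b] w by blast
qed

lemma affine_galois:
  assumes "u \<in> unitsR n" "w \<in> Rn n"
  shows "\<exists>\<sigma>\<in>carrier (galois_group \<phi>). \<forall>p. \<sigma> (param p) = param (mulR n u p + w)"
proof -
  obtain \<sigma> where "is_field_hom \<sigma>" "\<forall>a. \<sigma> (\<phi> a) = \<phi> a" "\<sigma> v = act u v" "\<sigma> b = b + act w v"
    using ex_hom[OF coeff_unitsR[OF _ assms(1)]] by auto
  then show ?thesis using hom_in_galois_group hom_param by metis
qed

text \<open>The action on the roots read in the coordinates \<open>param\<close>; restricted,
  because elements of \<open>affine_group\<close> are extensional functions.\<close>

definition param_conj :: "('b \<Rightarrow> 'b) \<Rightarrow> bit poly \<Rightarrow> bit poly" where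
  "param_conj \<sigma> = (\<lambda>p\<in>Rn n. inv_into (Rn n) param (\<sigma> (param p)))"

lemma affine_closed: "w \<in> Rn n \<Longrightarrow> mulR n u p + w \<in> Rn n"
  unfolding mulR_def by (intro Rn_add Rn_truncR) auto

lemma param_conj_eq:
  assumes "w \<in> Rn n" "\<And>p. \<sigma> (param p) = param (mulR n u p + w)"
  shows "param_conj \<sigma> = (\<lambda>p\<in>Rn n. mulR n u p + w)"
  unfolding param_conj_def
  using assms affine_closed inv_into_f_f[OF bij_betw_imp_inj_on[OF param_bij]]
  by (intro restrict_ext) simp

lemma param_conj:
  assumes "\<sigma> \<in> carrier (galois_group \<phi>)" "p \<in> Rn n"
  shows "param_conj \<sigma> p \<in> Rn n" "param (param_conj \<sigma> p) = \<sigma> (param p)"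
proof -
  obtain u w where "w \<in> Rn n" "\<And>p. \<sigma> (param p) = param (mulR n u p + w)"
    using galois_affine[OF assms(1)] by blast
  then show "param_conj \<sigma> p \<in> Rn n" "param (param_conj \<sigma> p) = \<sigma> (param p)"
    using assms(2) affine_closed param_conj_eq by simp_all
qed

text \<open>The elements on which the two agree form a subfield containing the base field and the
  roots.\<close>

lemma galois_group_eqI:
  assumes "\<sigma> \<in> carrier (galois_group \<phi>)" "\<tau> \<in> carrier (galois_group \<phi>)"
    and "\<And>a. a \<in> roots \<Longrightarrow> \<sigma> a = \<tau> a"
  shows "\<sigma> = \<tau>"
proof -
  note \<sigma> = galois_groupD[OF assms(1)] and \<tau> = galois_groupD[OF assms(2)]
  have "is_subfield {x. \<sigma> x = \<tau> x}"
    unfolding is_subfield_def by (simp add: is_field_hom_simps[OF \<sigma>(2)] is_field_hom_simps[OF \<tau>(2)])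
  then have "{x. \<sigma> x = \<tau> x} = UNIV" by (rule subfield_eq_UNIV) (use \<sigma> \<tau> assms(3) in auto)
  then show ?thesis by auto
qed

text \<open>Conjugation by the bijection \<open>param\<close> respects composition. It is injective
  because the roots determine an automorphism, and surjective by
  \<open>affine_galois\<close>.\<close>

lemma param_conj_iso: "param_conj \<in> iso (galois_group \<phi>) (affine_group n)"
proof (rule isoI)
  let ?G = "carrier (galois_group \<phi>)"
  have maps: "param_conj \<sigma> \<in> carrier (affine_group n)" if \<sigma>: "\<sigma> \<in> ?G" for \<sigma>
  proof -
    obtain u w where uw: "u \<in> unitsR n" "w \<in> Rn n" "\<And>p. \<sigma> (param p) = param (mulR n u p + w)"
      using galois_affine[OF \<sigma>] by blast
    show ?thesis unfolding param_conj_eq[OF uw(2,3)] affine_group_def using uw by auto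
  qed
  have inj: "inj_on param_conj ?G"
  proof
    fix \<sigma> \<tau> assume *: "\<sigma> \<in> ?G" "\<tau> \<in> ?G" "param_conj \<sigma> = param_conj \<tau>"
    show "\<sigma> = \<tau>"
    proof (rule galois_group_eqI[OF *(1,2)])
      fix a assume "a \<in> roots"
      then obtain p where "p \<in> Rn n" "a = param p" using param_bij unfolding bij_betw_def by blast
      then show "\<sigma> a = \<tau> a" using param_conj(2) * by metis
    qed
  qed
  have surj: "f \<in> param_conj ` ?G" if aff: "f \<in> carrier (affine_group n)" for f
  proof -
    obtain u w where f: "f = (\<lambda>p\<in>Rn n. mulR n u p + w)" "u \<in> unitsR n" "w \<in> Rn n"
      using aff unfolding affine_group_def by auto
    then obtain \<sigma> where \<sigma>: "\<sigma> \<in> ?G" "\<And>p. \<sigma> (param p) = param (mulR n u p + w)"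
      using affine_galois by blast
    show ?thesis unfolding f(1) param_conj_eq[OF f(3) \<sigma>(2), symmetric] using \<sigma>(1) by (rule imageI)
  qed
  show "bij_betw param_conj ?G (carrier (affine_group n))"
    unfolding bij_betw_def using maps inj surj by blast
  have closed: "\<sigma> \<circ> \<tau> \<in> ?G" if "\<sigma> \<in> ?G" "\<tau> \<in> ?G" for \<sigma> \<tau>
    using that by (auto simp: galois_group_def is_field_hom_def intro: bij_comp)
  show "param_conj \<in> hom (galois_group \<phi>) (affine_group n)"
  proof (rule homI)
    fix \<sigma> \<tau> assume *: "\<sigma> \<in> ?G" "\<tau> \<in> ?G"
    have "param_conj (\<sigma> \<circ> \<tau>) = compose (Rn n) (param_conj \<sigma>) (param_conj \<tau>)"
    proof
      fix p
      show "param_conj (\<sigma> \<circ> \<tau>) p = compose (Rn n) (param_conj \<sigma>) (param_conj \<tau>) p"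
      proof (cases "p \<in> Rn n")
        case True
        have "param (param_conj (\<sigma> \<circ> \<tau>) p) = param (param_conj \<sigma> (param_conj \<tau> p))"
          using param_conj closed * True by simp
        then have "param_conj (\<sigma> \<circ> \<tau>) p = param_conj \<sigma> (param_conj \<tau> p)"
          using inj_onD[OF bij_betw_imp_inj_on[OF param_bij]] param_conj(1) closed * True by blast
        then show ?thesis using True by (simp add: compose_def)
      qed (simp add: compose_def param_conj_def)
    qed
    then show "param_conj (\<sigma> \<otimes>\<^bsub>galois_group \<phi>\<^esub> \<tau>) = param_conj \<sigma> \<otimes>\<^bsub>affine_group n\<^esub> param_conj \<tau>"
      by (simp add: galois_group_def affine_group_def)
  qed (rule maps)
qed

end

theorem theorem5p3:
  fixes \<phi> :: "'k::field rat2 \<Rightarrow> 'l::field"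
  assumes "CHAR('k) = 2"
    and "n \<ge> 1"
    and "is_splitting_field \<phi> (Giter n)"
  shows "galois_group \<phi> \<cong> affine_group n"
proof -
  obtain m where n: "n = Suc m" using assms(2) by (cases n) auto
  interpret quadratic_iterate \<phi> m using assms n by unfold_locales simp_all
  obtain b v where "(g ^^ Suc m) b = 0" "(ell ^^ m) v = s" using ex_base_root_and_generator by blast
  then interpret quadratic_iterate_base \<phi> m b v by unfold_locales
  show ?thesis unfolding n by (rule is_isoI[OF param_conj_iso])
qed

end
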